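(* Let $K$ be a field of characteristic $0$, let $H=H[a_i]$ be the Heisenberg algebra over $K$ with non-zero parameters $a_i$, and let $V$ be a graded representation of $H$ with distinguished homogeneous basis $\{v_s : s\in S\}$ as described in the context. Let $b\in S$ be such that $v_b$ is a highest weight vector for $H$, and set $F_s:=F_{s/b}$, $G_s := G_{s/b}$ for $s\in S$. Then in the completion of $\Lambda_K(X)\otimes\Lambda_K(Y)$, $$\sum_{s\in S}F_s(x_1,x_2,\ldots)\,G_s(y_1,y_2,\ldots)=\prod_{j,k\ge1}\left(1+h_1\langle a_i\rangle x_jy_k+h_2\langle a_i\rangle(x_jy_k)^2+\cdots\right).$$ More generally, for any $r,t\in S$, $$\sum_{s\in S}F_{s/t}(x_1,x_2,\ldots)\,G_{s/r}(y_1,y_2,\ldots)=\prod_{j,k\ge1}\left(1+h_1\langle a_i\rangle x_jy_k+h_2\langle a_i\rangle(x_jy_k)^2+\cdots\right)\sum_{s\in S}F_{r/s}(x_1,x_2,\ldots)\,G_{t/s}(y_1,y_2,\ldots).$$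
   Context: Symmetric functions: $\Lambda_K$ is the ring of symmetric functions over $K$; $\Lambda_K(X)$, $\Lambda_K(Y)$ denote it in variables $x_1,x_2,\ldots$ and $y_1,y_2,\ldots$; $h_k$ and $p_k$ are the complete homogeneous and power sum symmetric functions. $h_k\langle a_i\rangle:=\kappa(h_k)\in K$, where $\kappa:\Lambda_K\to K$ is the $K$-algebra homomorphism with $\kappa(p_j)=a_j$ for $j\ge1$. Partitions: for a partition $\lambda$, $m_i(\lambda)$ is the number of parts equal to $i$, and $z_\lambda=\prod_{i\ge1} i^{m_i(\lambda)}m_i(\lambda)!$. Heisenberg algebra: given non-zero parameters $a_k\in K$ ($k\in\mathbb Z\setminus\{0\}$) with $a_k=a_{-k}$, $H=H[a_i]$ is the unital associative $K$-algebra generated by $\{B_k: k\in\mathbb Z\setminus\{0\}\}$ with relations $[B_k,B_l]=k\,a_k\,\delta_{k,-l}$. For a partition $\lambda=(\lambda_1,\ldots,\lambda_l)$ put $B_\lambda=B_{\lambda_1}\cdots B_{\lambda_l}$ and $B_{-\lambda}=B_{-\lambda_1}\cdots B_{-\lambda_l}$; for $k\ge 0$ put $D_k=\sum_{\lambda\vdash k}z_\lambda^{-1}B_\lambda$ and $U_k=\sum_{\lambda\vdash k}z_\lambda^{-1}B_{-\lambda}$ (so $D_0=U_0=1$). Representation: $V$ is a representation of $H$ with a distinguished basis $\{v_s: s\in S\}$. Both $V$ and $S$ are $\mathbb Z$-graded, each $v_s$ is homogeneous with $\deg(v_s)=\deg(s)$, each graded component of $V$ is finite-dimensional, and the action is graded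 in the sense that $\deg(B_k)=-mk$ for some fixed $m\in\mathbb Z\setminus\{0\}$. The inner product $\langle\cdot,\cdot\rangle:V\times V\to K$ is the bilinear form with $\langle v_s,v_{s'}\rangle=\delta_{ss'}$. A vector $v\in V$ is a highest weight vector if $B_k\cdot v=0$ for all $k>0$. Generating functions: for $s,t\in S$, $$F_{s/t}=\sum_\alpha x^\alpha\langle U_{\alpha_l}\cdots U_{\alpha_1}\cdot v_t,v_s\rangle,\qquad G_{s/t}=\sum_\alpha x^\alpha\langle D_{\alpha_l}\cdots D_{\alpha_1}\cdot v_s,v_t\rangle,$$ where $\alpha=(\alpha_1,\alpha_2,\ldots)$ runs over sequences of non-negative integers with finitely many non-zero terms and $x^\alpha=\prod_i x_i^{\alpha_i}$. These are symmetric functions, homogeneous of degree $(\deg(s)-\deg(t))/m$ (zero if this is negative or non-integral). *)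

theory Defs
  imports
    "HOL-Library.Poly_Mapping"
    "HOL-Algebra.QuotRing"
    "HOL-Algebra.Algebraic_Closure_Type"
begin

section \<open>Formal power series in arbitrarily many variables\<close>

text \<open>
  The variables are indexed by \<open>'i\<close> and a monomial is its finitely supported exponent vector.
  Arbitrary coefficient functions are allowed, so this is the ring \<open>K[[x_i : i \<in> 'i]]\<close>.
  Below, \<open>'i = nat\<close> is one alphabet (numbered from 0, so \<open>x\<^sub>1, x\<^sub>2, \<dots>\<close> are the variables
  0, 1, \dots), and \<open>'i = nat + nat\<close> is the union of two alphabets \<open>X\<close> (\<open>Inl\<close>) and \<open>Y\<close> (\<open>Inr\<close>).
\<close>

typedef ('i, 'k) mfps = "UNIV :: (('i \<Rightarrow>\<^sub>0 nat) \<Rightarrow> 'k) set"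
  morphisms mcoeff Abs_mfps ..

setup_lifting type_definition_mfps

lemma mfps_eqI: "(\<And>m. mcoeff f m = mcoeff g m) \<Longrightarrow> f = g"
  by (metis ext mcoeff_inject)

lemma mcoeff_Abs_mfps [simp]: "mcoeff (Abs_mfps c) m = c m"
  by (simp add: Abs_mfps_inverse)

definition splittings :: "('i \<Rightarrow>\<^sub>0 nat) \<Rightarrow> (('i \<Rightarrow>\<^sub>0 nat) \<times> ('i \<Rightarrow>\<^sub>0 nat)) set" where
  "splittings m = {(p, q). p + q = m}"

lemma mem_splittings: "(p, q) \<in> splittings m \<longleftrightarrow> p + q = m"
  by (simp add: splittings_def)

lemma finite_splittings [simp]: "finite (splittings m)"
proof -
  let ?N = "\<Sum>i\<in>Poly_Mapping.keys m. Poly_Mapping.lookup m i"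
  let ?A = "{f. \<forall>i. (i \<in> Poly_Mapping.keys m \<longrightarrow> f i \<in> {..?N})
                  \<and> (i \<notin> Poly_Mapping.keys m \<longrightarrow> f i = 0)}"
  have finA: "finite ?A"
    by (rule finite_set_of_finite_funs) auto
  have sub: "(\<lambda>(p, q). (Poly_Mapping.lookup p, Poly_Mapping.lookup q)) ` splittings m \<subseteq> ?A \<times> ?A"
  proof clarify
    fix p q assume "(p, q) \<in> splittings m"
    then have m: "m = p + q" by (simp add: mem_splittings)
    have le: "Poly_Mapping.lookup m i \<le> ?N" if "i \<in> Poly_Mapping.keys m" for i
      using that by (intro member_le_sum) auto
    have eq: "Poly_Mapping.lookup m i = Poly_Mapping.lookup p i + Poly_Mapping.lookup q i" for i
      by (simp add: m lookup_add)
    have "Poly_Mapping.lookup p i \<le> ?N" "Poly_Mapping.lookup q i \<le> ?N"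
      if "i \<in> Poly_Mapping.keys m" for i
      using le[OF that] unfolding eq[of i] by linarith+
    moreover have "Poly_Mapping.lookup p i = 0" "Poly_Mapping.lookup q i = 0"
      if "i \<notin> Poly_Mapping.keys m" for i
      using that eq[of i] by (simp_all add: in_keys_iff)
    ultimately show "Poly_Mapping.lookup p \<in> ?A \<and> Poly_Mapping.lookup q \<in> ?A"
      by (simp add: atMost_iff)
  qed
  show ?thesis
  proof (rule finite_imageD)
    show "finite ((\<lambda>(p, q). (Poly_Mapping.lookup p, Poly_Mapping.lookup q)) ` splittings m)"
      by (rule finite_subset[OF sub finite_cartesian_product[OF finA finA]])
    show "inj_on (\<lambda>(p, q). (Poly_Mapping.lookup p, Poly_Mapping.lookup q)) (splittings m)"
      by (auto simp: inj_on_def)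
  qed
qed

instantiation mfps :: (type, comm_ring_1) comm_ring_1
begin

lift_definition zero_mfps :: "('a, 'b) mfps" is "\<lambda>_. 0" .
lift_definition one_mfps :: "('a, 'b) mfps" is "\<lambda>m. if m = 0 then 1 else 0" .
lift_definition plus_mfps :: "('a, 'b) mfps \<Rightarrow> ('a, 'b) mfps \<Rightarrow> ('a, 'b) mfps"
  is "\<lambda>f g m. f m + g m" .
lift_definition minus_mfps :: "('a, 'b) mfps \<Rightarrow> ('a, 'b) mfps \<Rightarrow> ('a, 'b) mfps"
  is "\<lambda>f g m. f m - g m" .
lift_definition uminus_mfps :: "('a, 'b) mfps \<Rightarrow> ('a, 'b) mfps"
  is "\<lambda>f m. - f m" .
lift_definition times_mfps :: "('a, 'b) mfps \<Rightarrow> ('a, 'b) mfps \<Rightarrow> ('a, 'b) mfps"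
  is "\<lambda>f g m. \<Sum>(p, q)\<in>splittings m. f p * g q" .

instance
proof
  fix f g h :: "('a, 'b) mfps"
  show "f * g * h = f * (g * h)"
  proof (rule mfps_eqI)
    fix m
    have "mcoeff (f * g * h) m =
        (\<Sum>(r, z)\<in>splittings m. \<Sum>(x, y)\<in>splittings r. mcoeff f x * mcoeff g y * mcoeff h z)"
      by (simp add: times_mfps.rep_eq sum_distrib_right case_prod_unfold)
    also have "\<dots> = (\<Sum>(u, w)\<in>(SIGMA u:splittings m. splittings (fst u)).
        mcoeff f (fst w) * mcoeff g (snd w) * mcoeff h (snd u))"
      unfolding case_prod_unfold by (subst sum.Sigma) (simp_all add: case_prod_unfold)
    also have "\<dots> = (\<Sum>(u, w)\<in>(SIGMA u:splittings m. splittings (snd u)).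
        mcoeff f (fst u) * mcoeff g (fst w) * mcoeff h (snd w))"
      by (rule sum.reindex_bij_witness[where
            i = "\<lambda>(u, w). ((fst u + fst w, snd w), (fst u, fst w))" and
            j = "\<lambda>(u, w). ((fst w, snd w + snd u), (snd w, snd u))"])
         (auto simp: mem_splittings add.assoc)
    also have "\<dots> =
        (\<Sum>(x, r)\<in>splittings m. \<Sum>(y, z)\<in>splittings r. mcoeff f x * mcoeff g y * mcoeff h z)"
      unfolding case_prod_unfold by (subst sum.Sigma) (simp_all add: case_prod_unfold)
    also have "\<dots> = mcoeff (f * (g * h)) m"
      by (simp add: times_mfps.rep_eq sum_distrib_left case_prod_unfold mult.assoc)
    finally show "mcoeff (f * g * h) m = mcoeff (f * (g * h)) m" .
  qed
  show "f * g = g * f"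
  proof (rule mfps_eqI)
    fix m
    show "mcoeff (f * g) m = mcoeff (g * f) m"
      unfolding times_mfps.rep_eq
      by (rule sum.reindex_bij_witness[where i = "\<lambda>(p, q). (q, p)" and j = "\<lambda>(p, q). (q, p)"])
         (auto simp: mem_splittings add.commute mult.commute)
  qed
  show "1 * f = f"
  proof (rule mfps_eqI)
    fix m
    have "mcoeff (1 * f) m = (\<Sum>(p, q)\<in>{(0 :: 'a \<Rightarrow>\<^sub>0 nat, m)}. (if p = 0 then 1 else 0) * mcoeff f q)"
      unfolding times_mfps.rep_eq one_mfps.rep_eq
      by (rule sum.mono_neutral_right[OF finite_splittings]) (auto simp: splittings_def split: if_splits)
    then show "mcoeff (1 * f) m = mcoeff f m" by simp
  qed
  show "(f + g) * h = f * h + g * h"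
    by (rule mfps_eqI)
       (simp add: times_mfps.rep_eq plus_mfps.rep_eq case_prod_unfold distrib_right sum.distrib)
  show "(0 :: ('a, 'b) mfps) \<noteq> 1"
  proof
    assume "(0 :: ('a, 'b) mfps) = 1"
    then have "mcoeff (0 :: ('a, 'b) mfps) 0 = mcoeff 1 0" by simp
    then show False by (simp add: one_mfps.rep_eq zero_mfps.rep_eq)
  qed
  show "f + g + h = f + (g + h)"
    by (rule mfps_eqI) (simp add: plus_mfps.rep_eq add.assoc)
  show "f + g = g + f"
    by (rule mfps_eqI) (simp add: plus_mfps.rep_eq add.commute)
  show "0 + f = f"
    by (rule mfps_eqI) (simp add: plus_mfps.rep_eq zero_mfps.rep_eq)
  show "- f + f = 0"
    by (rule mfps_eqI) (simp add: plus_mfps.rep_eq uminus_mfps.rep_eq zero_mfps.rep_eq)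
  show "f - g = f + - g"
    by (rule mfps_eqI) (simp add: plus_mfps.rep_eq minus_mfps.rep_eq uminus_mfps.rep_eq)
qed

end

definition mfps_const :: "'k \<Rightarrow> ('i, 'k::comm_ring_1) mfps" where
  "mfps_const c = Abs_mfps (\<lambda>m. if m = 0 then c else 0)"

definition mdeg :: "('i \<Rightarrow>\<^sub>0 nat) \<Rightarrow> nat" where
  "mdeg m = (\<Sum>i\<in>Poly_Mapping.keys m. Poly_Mapping.lookup m i)"

text \<open>
  An infinite product converges to \<open>g\<close> if every coefficient of the finite partial products is
  eventually equal to the corresponding coefficient of \<open>g\<close>.
\<close>

definition has_formal_prod :: "('j \<Rightarrow> ('i, 'k::comm_ring_1) mfps) \<Rightarrow> ('i, 'k) mfps \<Rightarrow> bool" where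
  "has_formal_prod f g \<longleftrightarrow>
     (\<forall>m. \<forall>\<^sub>F J in finite_subsets_at_top UNIV. mcoeff (\<Prod>j\<in>J. f j) m = mcoeff g m)"


section \<open>Symmetric functions\<close>

definition sym_fun :: "(nat, 'k::comm_ring_1) mfps set" where
  "sym_fun = {f. (\<forall>\<pi> m. bij \<pi> \<longrightarrow> mcoeff f (Poly_Mapping.map_key \<pi> m) = mcoeff f m) \<and>
                 (\<exists>d. \<forall>m. mcoeff f m \<noteq> 0 \<longrightarrow> mdeg m \<le> d)}"

definition complete_sym :: "nat \<Rightarrow> (nat, 'k::comm_ring_1) mfps" where
  "complete_sym k = Abs_mfps (\<lambda>m. if mdeg m = k then 1 else 0)"

text \<open>Only meaningful for \<open>k \<ge> 1\<close>.\<close>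

definition power_sum :: "nat \<Rightarrow> (nat, 'k::comm_ring_1) mfps" where
  "power_sum k = Abs_mfps (\<lambda>m. if \<exists>i. m = Poly_Mapping.single i k then 1 else 0)"

text \<open>
  \<open>\<kappa>\<close> is the \<open>K\<close>-algebra homomorphism from the ring of symmetric functions to \<open>K\<close> with
  \<open>p\<^sub>j \<mapsto> a\<^sub>j\<close>; its values outside \<open>sym_fun\<close> are irrelevant.
\<close>

locale power_sum_specialization =
  fixes a :: "int \<Rightarrow> 'k::field_char_0" and \<kappa> :: "(nat, 'k) mfps \<Rightarrow> 'k"
  assumes kappa_one: "\<kappa> 1 = 1"
    and kappa_add: "\<lbrakk>f \<in> sym_fun; g \<in> sym_fun\<rbrakk> \<Longrightarrow> \<kappa> (f + g) = \<kappa> f + \<kappa> g"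
    and kappa_mult: "\<lbrakk>f \<in> sym_fun; g \<in> sym_fun\<rbrakk> \<Longrightarrow> \<kappa> (f * g) = \<kappa> f * \<kappa> g"
    and kappa_scale: "f \<in> sym_fun \<Longrightarrow> \<kappa> (mfps_const c * f) = c * \<kappa> f"
    and kappa_power_sum: "j \<ge> 1 \<Longrightarrow> \<kappa> (power_sum j) = a (int j)"


subsection \<open>Two alphabets and the completed tensor product\<close>

definition in_X :: "(nat, 'k::comm_ring_1) mfps \<Rightarrow> (nat + nat, 'k) mfps" where
  "in_X f = Abs_mfps (\<lambda>m. if Poly_Mapping.map_key Inr m = 0
                          then mcoeff f (Poly_Mapping.map_key Inl m) else 0)"

definition in_Y :: "(nat, 'k::comm_ring_1) mfps \<Rightarrow> (nat + nat, 'k) mfps" where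
  "in_Y f = Abs_mfps (\<lambda>m. if Poly_Mapping.map_key Inl m = 0
                          then mcoeff f (Poly_Mapping.map_key Inr m) else 0)"

text \<open>
  With \<open>\<Lambda>\<^sup>i\<close> the homogeneous part of degree \<open>i\<close>, the space \<open>\<Lambda>\<^sup>i(X) \<otimes> \<Lambda>\<^sup>j(Y)\<close> consists of the power
  series that are homogeneous of bidegree \<open>(i, j)\<close> and symmetric in \<open>X\<close> and in \<open>Y\<close> separately (the
  products of monomial symmetric functions form a basis of both).  So the completion of
  \<open>\<Lambda>(X) \<otimes> \<Lambda>(Y)\<close>, i.e. the direct product of these spaces over all \<open>(i, j)\<close>, is the following set,
  and a series converges in it iff each of its bihomogeneous components is a finite sum.
\<close>

definition sym_fun_XY :: "(nat + nat, 'k::comm_ring_1) mfps set" where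
  "sym_fun_XY = {f. \<forall>\<pi> \<sigma> m. bij \<pi> \<longrightarrow> bij \<sigma> \<longrightarrow>
     mcoeff f (Poly_Mapping.map_key (map_sum \<pi> \<sigma>) m) = mcoeff f m}"

definition bihom_part :: "nat \<Rightarrow> nat \<Rightarrow> (nat + nat, 'k::comm_ring_1) mfps \<Rightarrow> (nat + nat, 'k) mfps" where
  "bihom_part i j f = Abs_mfps (\<lambda>m.
     if mdeg (Poly_Mapping.map_key Inl m) = i \<and> mdeg (Poly_Mapping.map_key Inr m) = j
     then mcoeff f m else 0)"

definition has_completed_sum ::
  "('s \<Rightarrow> (nat + nat, 'k::comm_ring_1) mfps) \<Rightarrow> (nat + nat, 'k) mfps \<Rightarrow> bool" where
  "has_completed_sum f g \<longleftrightarrow>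
     range f \<subseteq> sym_fun_XY \<and> g \<in> sym_fun_XY \<and>
     (\<forall>i j. finite {s. bihom_part i j (f s) \<noteq> 0} \<and>
            (\<Sum>s | bihom_part i j (f s) \<noteq> 0. bihom_part i j (f s)) = bihom_part i j g)"

text \<open>
  Here \<open>j\<close>, \<open>k\<close> are variable indices: the series is \<open>1 + c\<^sub>1 x\<^sub>j y\<^sub>k + c\<^sub>2 (x\<^sub>j y\<^sub>k)\<^sup>2 + \<dots>\<close>.
\<close>

definition diag_series :: "(nat \<Rightarrow> 'k::comm_ring_1) \<Rightarrow> nat \<Rightarrow> nat \<Rightarrow> (nat + nat, 'k) mfps" where
  "diag_series c j k = Abs_mfps (\<lambda>m. let n = Poly_Mapping.lookup m (Inl j) in
     if m = Poly_Mapping.single (Inl j) n + Poly_Mapping.single (Inr k) n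
     then (if n = 0 then 1 else c n) else 0)"


section \<open>The Heisenberg algebra\<close>

text \<open>
  The free algebra on the generators \<open>B\<^sub>k\<close>, \<open>k \<noteq> 0\<close>, is the monoid algebra of the monoid of words in
  non-zero integers; its multiplication is the convolution product on \<open>hword \<Rightarrow>\<^sub>0 'k\<close>.
\<close>

typedef hword = "{w :: int list. 0 \<notin> set w}"
  morphisms letters Abs_hword
  by (rule exI[of _ "[]"]) simp

setup_lifting type_definition_hword

instantiation hword :: monoid_add
begin

lift_definition zero_hword :: hword is "[]" by simp
lift_definition plus_hword :: "hword \<Rightarrow> hword \<Rightarrow> hword" is append by simp

instance
  by standard (transfer; simp)+

end

type_synonym 'k hfree = "hword \<Rightarrow>\<^sub>0 'k"

definition hscalar :: "'k::field_char_0 \<Rightarrow> 'k hfree" where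
  "hscalar c = Poly_Mapping.single 0 c"

text \<open>Only meaningful for \<open>k \<noteq> 0\<close>.\<close>

definition hgen :: "int \<Rightarrow> 'k::field_char_0 hfree" where
  "hgen k = Poly_Mapping.single (Abs_hword [k]) 1"

definition heis_relations :: "(int \<Rightarrow> 'k::field_char_0) \<Rightarrow> 'k hfree set" where
  "heis_relations a =
     {hgen k * hgen l - hgen l * hgen k - hscalar (if k = - l then of_int k * a k else 0) | k l.
        k \<noteq> 0 \<and> l \<noteq> 0}"

definition heis_ideal :: "(int \<Rightarrow> 'k::field_char_0) \<Rightarrow> 'k hfree set" where
  "heis_ideal a = genideal (ring_of_type_algebra :: 'k hfree ring) (heis_relations a)"

definition heisenberg :: "(int \<Rightarrow> 'k::field_char_0) \<Rightarrow> 'k hfree set ring" where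
  "heisenberg a = (ring_of_type_algebra :: 'k hfree ring) Quot heis_ideal a"

text \<open>The canonical projection of the free algebra onto the Heisenberg algebra.\<close>

definition heis_class :: "(int \<Rightarrow> 'k::field_char_0) \<Rightarrow> 'k hfree \<Rightarrow> 'k hfree set" where
  "heis_class a x = heis_ideal a +>\<^bsub>(ring_of_type_algebra :: 'k hfree ring)\<^esub> x"

abbreviation heis_B :: "(int \<Rightarrow> 'k::field_char_0) \<Rightarrow> int \<Rightarrow> 'k hfree set" where
  "heis_B a k \<equiv> heis_class a (hgen k)"

definition partitions :: "nat \<Rightarrow> nat list set" where
  "partitions k = {\<mu>. sorted_wrt (\<ge>) \<mu> \<and> 0 \<notin> set \<mu> \<and> sum_list \<mu> = k}"

definition zee :: "nat list \<Rightarrow> nat" where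
  "zee \<mu> = (\<Prod>i\<in>set \<mu>. i ^ count_list \<mu> i * fact (count_list \<mu> i))"

definition heis_D :: "(int \<Rightarrow> 'k::field_char_0) \<Rightarrow> nat \<Rightarrow> 'k hfree set" where
  "heis_D a k = heis_class a
     (\<Sum>\<mu>\<in>partitions k. hscalar (inverse (of_nat (zee \<mu>))) * prod_list (map (\<lambda>i. hgen (int i)) \<mu>))"

definition heis_U :: "(int \<Rightarrow> 'k::field_char_0) \<Rightarrow> nat \<Rightarrow> 'k hfree set" where
  "heis_U a k = heis_class a
     (\<Sum>\<mu>\<in>partitions k. hscalar (inverse (of_nat (zee \<mu>))) * prod_list (map (\<lambda>i. hgen (- int i)) \<mu>))"


section \<open>Graded representations with a distinguished basis\<close>

definition End_ring :: "('k::field \<Rightarrow> 'v::ab_group_add \<Rightarrow> 'v) \<Rightarrow> ('v \<Rightarrow> 'v) ring" where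
  "End_ring scale = \<lparr>carrier = {f. Vector_Spaces.linear scale scale f},
     monoid.mult = (\<circ>), one = id, ring.zero = (\<lambda>_. 0), add = (\<lambda>f g x. f x + g x)\<rparr>"

text \<open>
  \<open>act\<close> is the representation as a \<open>K\<close>-algebra homomorphism to the endomorphisms of \<open>V\<close>,
  \<open>gr n\<close> is the component of \<open>V\<close> of degree \<open>n\<close>, and \<open>ip\<close> is the inner product.
  The index set \<open>S\<close> of the basis is the type \<open>'s\<close>, graded by \<open>sdeg\<close>.
\<close>

locale graded_heisenberg_rep = vector_space scale
  for scale :: "'k::field_char_0 \<Rightarrow> 'v::ab_group_add \<Rightarrow> 'v" +
  fixes a :: "int \<Rightarrow> 'k"
    and act :: "'k hfree set \<Rightarrow> 'v \<Rightarrow> 'v"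
    and v :: "'s \<Rightarrow> 'v"
    and sdeg :: "'s \<Rightarrow> int"
    and gr :: "int \<Rightarrow> 'v set"
    and m :: int
    and ip :: "'v \<Rightarrow> 'v \<Rightarrow> 'k"
  assumes act_hom: "act \<in> ring_hom (heisenberg a) (End_ring scale)"
    and act_scalar: "act (heis_class a (hscalar c)) = scale c"
    and basis_inj: "inj v"
    and basis_independent: "\<not> dependent (range v)"
    and basis_span: "span (range v) = UNIV"
    and gr_subspace: "subspace (gr n)"
    and gr_direct_sum: "\<exists>!c. finite {n. c n \<noteq> 0} \<and> (\<forall>n. c n \<in> gr n) \<and> w = (\<Sum>n | c n \<noteq> 0. c n)"
    and basis_homogeneous: "v s \<in> gr (sdeg s)"
    and gr_finite_dim: "\<exists>A. finite A \<and> span A = gr n"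
    and m_nonzero: "m \<noteq> 0"
    and act_graded: "\<lbrakk>k \<noteq> 0; w \<in> gr n\<rbrakk> \<Longrightarrow> act (heis_B a k) w \<in> gr (n - m * k)"
    and ip_linear_left: "Vector_Spaces.linear scale (*) (\<lambda>u. ip u w)"
    and ip_linear_right: "Vector_Spaces.linear scale (*) (\<lambda>w. ip u w)"
    and ip_basis: "ip (v s) (v s') = (if s = s' then 1 else 0)"

definition highest_weight_vector ::
  "(int \<Rightarrow> 'k::field_char_0) \<Rightarrow> ('k hfree set \<Rightarrow> 'v::ab_group_add \<Rightarrow> 'v) \<Rightarrow> 'v \<Rightarrow> bool" where
  "highest_weight_vector a act w \<longleftrightarrow> (\<forall>k>0. act (heis_B a k) w = 0)"

text \<open>
  \<open>act_seq act E \<alpha> w = E\<^bsub>\<alpha>\<^sub>l\<^esub> \<cdots> E\<^bsub>\<alpha>\<^sub>1\<^esub> \<cdot> w\<close>, where \<open>l\<close> is minimal such that \<open>\<alpha>\<close> vanishes beyond its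
  first \<open>l\<close> entries (\<open>Poly_Mapping.degree\<close>).  Since \<open>U\<^sub>0 = D\<^sub>0 = 1\<close>, any larger \<open>l\<close> gives the same.
\<close>

definition act_seq ::
  "('h \<Rightarrow> 'v \<Rightarrow> 'v) \<Rightarrow> (nat \<Rightarrow> 'h) \<Rightarrow> (nat \<Rightarrow>\<^sub>0 nat) \<Rightarrow> 'v \<Rightarrow> 'v" where
  "act_seq act E \<alpha> w =
     fold (\<lambda>i. act (E (Poly_Mapping.lookup \<alpha> i))) [0..<Poly_Mapping.degree \<alpha>] w"

definition skew_F ::
  "(int \<Rightarrow> 'k::field_char_0) \<Rightarrow> ('k hfree set \<Rightarrow> 'v \<Rightarrow> 'v) \<Rightarrow> ('s \<Rightarrow> 'v) \<Rightarrow> ('v \<Rightarrow> 'v \<Rightarrow> 'k) \<Rightarrow>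
   's \<Rightarrow> 's \<Rightarrow> (nat, 'k) mfps" where
  "skew_F a act v ip s t = Abs_mfps (\<lambda>\<alpha>. ip (act_seq act (heis_U a) \<alpha> (v t)) (v s))"

definition skew_G ::
  "(int \<Rightarrow> 'k::field_char_0) \<Rightarrow> ('k hfree set \<Rightarrow> 'v \<Rightarrow> 'v) \<Rightarrow> ('s \<Rightarrow> 'v) \<Rightarrow> ('v \<Rightarrow> 'v \<Rightarrow> 'k) \<Rightarrow>
   's \<Rightarrow> 's \<Rightarrow> (nat, 'k) mfps" where
  "skew_G a act v ip s t = Abs_mfps (\<lambda>\<alpha>. ip (act_seq act (heis_D a) \<alpha> (v s)) (v t))"

end

theory Submission
  imports Defs
begin

text \<open>
  Newton's recursions \<open>n D\<^sub>n = \<Sum>\<^sub>i B\<^sub>i D\<^sub>n\<^sub>-\<^sub>i\<close>, \<open>n U\<^sub>n = \<Sum>\<^sub>i B\<^sub>-\<^sub>i U\<^sub>n\<^sub>-\<^sub>i\<close> and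
  \<open>n h\<^sub>n = \<Sum>\<^sub>i p\<^sub>i h\<^sub>n\<^sub>-\<^sub>i\<close> give \<open>[B\<^sub>i, U\<^sub>n] = a\<^sub>i U\<^sub>n\<^sub>-\<^sub>i\<close> and then
  \<open>D\<^sub>n U\<^sub>l = \<Sum>\<^sub>k h\<^sub>k\<langle>a\<rangle> U\<^sub>l\<^sub>-\<^sub>k D\<^sub>n\<^sub>-\<^sub>k\<close>, that is, moving \<open>U(x) = \<Sum> U\<^sub>n x\<^sup>n\<close> to the left of
  \<open>D(y) = \<Sum> D\<^sub>n y\<^sup>n\<close> costs the factor \<open>\<Sum> h\<^sub>k\<langle>a\<rangle> (x y)\<^sup>k\<close>.  Inserting the basis, the two sums over
  \<open>s\<close> are the matrix coefficients of \<open>\<Prod> D(y\<^sub>k) \<Prod> U(x\<^sub>j)\<close> and of \<open>\<Prod> U(x\<^sub>j) \<Prod> D(y\<^sub>k)\<close> from \<open>v\<^sub>t\<close> to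
  \<open>v\<^sub>r\<close>, so they differ by one such factor for each pair \<open>(j, k)\<close>.  A given coefficient involves
  only finitely many variables, which reduces the reordering to finite words.  If \<open>t = r = b\<close> and
  \<open>v\<^sub>b\<close> is a highest weight vector, the second matrix coefficient is \<open>1\<close> for degree reasons.
\<close>

section \<open>Monomials and power series\<close>

lemma lookup_map_key:
  "inj f \<Longrightarrow> Poly_Mapping.lookup (Poly_Mapping.map_key f m) i = Poly_Mapping.lookup m (f i)"
  by (simp add: Poly_Mapping.map_key.rep_eq)

lemma mdeg_eq_sum:
  assumes "finite A" "Poly_Mapping.keys m \<subseteq> A"
  shows "mdeg m = (\<Sum>i\<in>A. Poly_Mapping.lookup m i)"
  unfolding mdeg_def using assms by (intro sum.mono_neutral_left) (auto simp: in_keys_iff)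

lemma mdeg_add: "mdeg (p + q) = mdeg p + mdeg q"
proof -
  let ?A = "Poly_Mapping.keys p \<union> Poly_Mapping.keys q"
  have "Poly_Mapping.keys (p + q) \<subseteq> ?A"
    by (auto simp: in_keys_iff lookup_add)
  then show ?thesis
    by (simp add: mdeg_eq_sum[of ?A] lookup_add sum.distrib)
qed

lemma mdeg_single [simp]: "mdeg (Poly_Mapping.single i n) = n"
  by (simp add: mdeg_def)

lemma mdeg_eq_0_iff: "mdeg m = 0 \<longleftrightarrow> m = 0"
  by (metis (mono_tags, lifting) finite_keys in_keys_iff keys_eq_empty lookup_zero mdeg_def
      sum.empty sum_eq_0_iff equals0I)

lemma mdeg_map_key:
  assumes "bij \<pi>"
  shows "mdeg (Poly_Mapping.map_key \<pi> m) = mdeg m"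
proof -
  have "bij_betw \<pi> (\<pi> -` Poly_Mapping.keys m) (Poly_Mapping.keys m)"
    using assms by (simp add: bij_betw_def surj_image_vimage_eq inj_on_subset[of _ UNIV])
  then show ?thesis
    unfolding mdeg_def using assms
    by (simp add: keys_map_key bij_is_inj lookup_map_key sum.reindex_bij_betw)
qed

lemma map_key_inverse:
  assumes "bij \<pi>"
  shows "Poly_Mapping.map_key \<pi> (Poly_Mapping.map_key (inv_into UNIV \<pi>) m) = m"
    and "Poly_Mapping.map_key (inv_into UNIV \<pi>) (Poly_Mapping.map_key \<pi> m) = m"
  using assms
  by (auto intro!: poly_mapping_eqI
      simp: lookup_map_key bij_is_inj bij_imp_bij_inv bij_is_surj surj_f_inv_f inv_f_f)

text \<open>Describes the splittings whose first factor is a power of one variable. Subtraction of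
  exponents is truncated, so the bound on \<open>n\<close> is what makes
  \<open>m - Poly_Mapping.single i n\<close> a genuine quotient.\<close>

lemma single_plus_eq_iff:
  "Poly_Mapping.single i n + q = m \<longleftrightarrow>
     n \<le> Poly_Mapping.lookup m i \<and> q = m - Poly_Mapping.single i (n :: nat)"
  by (auto intro!: poly_mapping_eqI simp: lookup_add lookup_minus lookup_single when_def)

lemma two_singles_plus_eq_iff:
  assumes "i \<noteq> j"
  shows "Poly_Mapping.single i n + Poly_Mapping.single j n + q = m \<longleftrightarrow>
     n \<le> min (Poly_Mapping.lookup m i) (Poly_Mapping.lookup m j) \<and>
     q = m - (Poly_Mapping.single i n + Poly_Mapping.single j (n :: nat))"
  using assms
  by (auto intro!: poly_mapping_eqI simp: lookup_add lookup_minus lookup_single when_def)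

lemmas mcoeff_simps = zero_mfps.rep_eq one_mfps.rep_eq plus_mfps.rep_eq

lemma mcoeff_sum: "mcoeff (\<Sum>i\<in>A. f i) m = (\<Sum>i\<in>A. mcoeff (f i) m)"
  by (induction A rule: infinite_finite_induct) (simp_all add: mcoeff_simps)

text \<open>The convolution collapses to one term when the supports of the factors admit a single
  splitting of \<open>m\<close>, as for a constant factor or for factors in disjoint sets of
  variables.\<close>

lemma mcoeff_times_unique:
  assumes "p + q = m"
    and "\<And>p' q'. p' + q' = m \<Longrightarrow> mcoeff f p' \<noteq> 0 \<Longrightarrow> mcoeff g q' \<noteq> 0 \<Longrightarrow> p' = p"
  shows "mcoeff (f * g) m = mcoeff f p * mcoeff g q"
proof -
  have "mcoeff (f * g) m = (\<Sum>(p, q)\<in>{(p, q)}. mcoeff f p * mcoeff g q)"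
    unfolding times_mfps.rep_eq
  proof (rule sum.mono_neutral_right)
    show "\<forall>s\<in>splittings m - {(p, q)}. (case s of (p, q) \<Rightarrow> mcoeff f p * mcoeff g q) = 0"
    proof
      fix s assume s: "s \<in> splittings m - {(p, q)}"
      obtain p' q' where s_eq: "s = (p', q')" by (cases s)
      have eq: "p' + q' = m" and ne: "(p', q') \<noteq> (p, q)"
        using s by (auto simp: s_eq mem_splittings)
      have "\<not> (mcoeff f p' \<noteq> 0 \<and> mcoeff g q' \<noteq> 0)"
      proof
        assume *: "mcoeff f p' \<noteq> 0 \<and> mcoeff g q' \<noteq> 0"
        have "p' = p" by (rule assms(2)[OF eq]) (use * in auto)
        with eq assms(1) ne show False by auto
      qed
      then show "(case s of (p, q) \<Rightarrow> mcoeff f p * mcoeff g q) = 0" by (auto simp: s_eq)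
    qed
  qed (use assms(1) in \<open>auto simp: mem_splittings\<close>)
  then show ?thesis by simp
qed

lemma mcoeff_const_times: "mcoeff (mfps_const c * f) m = c * mcoeff f m"
  by (subst mcoeff_times_unique[of 0 m])
     (auto simp: mfps_const_def split: if_splits)

text \<open>A monomial factors uniquely into an X-part and a Y-part, and the two embedded series are
  supported on pure X- and pure Y-monomials.\<close>

lemma mcoeff_in_X_times_in_Y:
  "mcoeff (in_X f * in_Y g) m =
     mcoeff f (Poly_Mapping.map_key Inl m) * mcoeff g (Poly_Mapping.map_key Inr m)"
proof -
  have fin: "finite {x. (Poly_Mapping.lookup m x when x \<in> A) \<noteq> 0}" for A
    by (rule finite_subset[of _ "Poly_Mapping.keys m"]) (auto simp: in_keys_iff when_def)
  \<comment> \<open>\<open>p\<close> and \<open>q\<close> are the X-part and the Y-part of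
    \<open>m\<close>; \<open>fin\<close> allows their exponents to be read off through
    \<open>Abs_poly_mapping\<close>.\<close>
  define p where "p = Abs_poly_mapping (\<lambda>x. Poly_Mapping.lookup m x when x \<in> range Inl)"
  define q where "q = Abs_poly_mapping (\<lambda>x. Poly_Mapping.lookup m x when x \<in> range Inr)"
  have lp: "Poly_Mapping.lookup p x = (Poly_Mapping.lookup m x when x \<in> range Inl)"
    and lq: "Poly_Mapping.lookup q x = (Poly_Mapping.lookup m x when x \<in> range Inr)" for x
    unfolding p_def q_def using fin by (simp_all add: Abs_poly_mapping_inverse)
  have pX: "Poly_Mapping.map_key Inl p = Poly_Mapping.map_key Inl m"
    "Poly_Mapping.map_key Inr p = 0"
    "Poly_Mapping.map_key Inr q = Poly_Mapping.map_key Inr m"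
    "Poly_Mapping.map_key Inl q = 0"
    by (auto intro!: poly_mapping_eqI simp: lookup_map_key lp lq when_def)
  have "mcoeff (in_X f * in_Y g) m = mcoeff (in_X f) p * mcoeff (in_Y g) q"
  proof (rule mcoeff_times_unique)
    show "p + q = m"
    proof (rule poly_mapping_eqI)
      fix x show "Poly_Mapping.lookup (p + q) x = Poly_Mapping.lookup m x"
        by (cases x) (auto simp: lookup_add lp lq when_def)
    qed
    show "p' = p" if eq: "p' + q' = m" and "mcoeff (in_X f) p' \<noteq> 0" "mcoeff (in_Y g) q' \<noteq> 0" for p' q'
    proof -
    from that have "Poly_Mapping.map_key Inr p' = 0" "Poly_Mapping.map_key Inl q' = 0"
      by (auto simp: in_X_def in_Y_def split: if_splits)
    then have 0: "Poly_Mapping.lookup p' (Inr i) = 0" "Poly_Mapping.lookup q' (Inl j) = 0" for i j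
      by (metis lookup_map_key inj_Inr lookup_zero) (metis \<open>Poly_Mapping.map_key Inl q' = 0\<close> lookup_map_key inj_Inl lookup_zero)
    show "p' = p"
    proof (rule poly_mapping_eqI)
      fix x show "Poly_Mapping.lookup p' x = Poly_Mapping.lookup p x"
        unfolding lp eq[symmetric] by (cases x) (auto simp: lookup_add 0 when_def)
    qed
    qed
  qed
  then show ?thesis by (simp add: in_X_def in_Y_def pX)
qed

lemma map_key_map_sum:
  assumes "bij \<pi>" "bij \<sigma>"
  shows "Poly_Mapping.map_key Inl (Poly_Mapping.map_key (map_sum \<pi> \<sigma>) m) =
      Poly_Mapping.map_key \<pi> (Poly_Mapping.map_key Inl m)"
    and "Poly_Mapping.map_key Inr (Poly_Mapping.map_key (map_sum \<pi> \<sigma>) m) =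
      Poly_Mapping.map_key \<sigma> (Poly_Mapping.map_key Inr m)"
proof -
  have "inj \<pi>" "inj \<sigma>" using assms by (auto simp: bij_is_inj)
  moreover from this have "inj (map_sum \<pi> \<sigma>)" by (rule sum.inj_map)
  ultimately show "Poly_Mapping.map_key Inl (Poly_Mapping.map_key (map_sum \<pi> \<sigma>) m) =
      Poly_Mapping.map_key \<pi> (Poly_Mapping.map_key Inl m)"
    "Poly_Mapping.map_key Inr (Poly_Mapping.map_key (map_sum \<pi> \<sigma>) m) =
      Poly_Mapping.map_key \<sigma> (Poly_Mapping.map_key Inr m)"
    by (auto intro!: poly_mapping_eqI simp: lookup_map_key)
qed

text \<open>The series lives on the powers of \<open>x_j y_k\<close>, which are pairwise distinct,
  so only splittings that remove such a power from \<open>m\<close> count.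
  \<open>diag_series\<close> has constant term 1 whatever \<open>c 0\<close> is;
  \<open>c 0 = 1\<close> makes the summand \<open>n = 0\<close> agree with it.\<close>

lemma mcoeff_diag_series_times:
  fixes f :: "(nat + nat, 'k::comm_ring_1) mfps"
  assumes "c 0 = 1"
  shows "mcoeff (diag_series c j k * f) m =
    (\<Sum>n\<le>min (Poly_Mapping.lookup m (Inl j)) (Poly_Mapping.lookup m (Inr k)).
       c n * mcoeff f (m - (Poly_Mapping.single (Inl j) n + Poly_Mapping.single (Inr k) n)))"
proof -
  define e where "e n = Poly_Mapping.single (Inl j :: nat + nat) n + Poly_Mapping.single (Inr k) n"
    for n :: nat
  let ?N = "min (Poly_Mapping.lookup m (Inl j)) (Poly_Mapping.lookup m (Inr k))"
  have le: "Poly_Mapping.lookup (e n) (Inl j) = n" for n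
    by (simp add: e_def lookup_add lookup_single)
  have inj: "inj e" by (rule injI) (metis le)
  have ce: "mcoeff (diag_series c j k) (e n) = c n" for n
    using assms le[of n] by (simp add: diag_series_def e_def)
  have c0: "mcoeff (diag_series c j k) p = 0" if "p \<notin> range e" for p
  proof -
    have "p \<noteq> e n" for n using that by auto
    then show ?thesis by (simp add: diag_series_def Let_def e_def)
  qed
  have split: "e n + q = m \<longleftrightarrow> n \<le> ?N \<and> q = m - e n" for n q
    unfolding e_def by (rule two_singles_plus_eq_iff) simp
  have "mcoeff (diag_series c j k * f) m =
      (\<Sum>(p, q)\<in>(\<lambda>n. (e n, m - e n)) ` {..?N}. mcoeff (diag_series c j k) p * mcoeff f q)"
    unfolding times_mfps.rep_eq
  proof (rule sum.mono_neutral_right)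
    show "(\<lambda>n. (e n, m - e n)) ` {..?N} \<subseteq> splittings m"
      using split by (auto simp: mem_splittings)
    show "\<forall>s\<in>splittings m - (\<lambda>n. (e n, m - e n)) ` {..?N}.
        (case s of (p, q) \<Rightarrow> mcoeff (diag_series c j k) p * mcoeff f q) = 0"
    proof
      fix s assume s: "s \<in> splittings m - (\<lambda>n. (e n, m - e n)) ` {..?N}"
      obtain p q where pq: "s = (p, q)" by (cases s)
      have "p \<notin> range e"
      proof
        assume "p \<in> range e"
        then obtain n where "p = e n" by auto
        then show False using s pq split[of n q] by (auto simp: mem_splittings)
      qed
      then show "(case s of (p, q) \<Rightarrow> mcoeff (diag_series c j k) p * mcoeff f q) = 0"
        by (simp add: c0 pq)
    qed
  qed simp
  also have "\<dots> = (\<Sum>n\<le>?N. c n * mcoeff f (m - e n))"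
    by (subst sum.reindex) (auto simp: inj_on_def ce dest: injD[OF inj])
  finally show ?thesis by (simp add: e_def)
qed

text \<open>If one of the two variables is missing from \<open>m\<close>, only the term
  \<open>n = 0\<close> survives. Hence a coefficient of the infinite product sees finitely many
  factors.\<close>

lemma mcoeff_diag_series_times_trivial:
  assumes "c 0 = 1" "Poly_Mapping.lookup m (Inl j) = 0 \<or> Poly_Mapping.lookup m (Inr k) = 0"
  shows "mcoeff (diag_series c j k * f) m = mcoeff f m"
proof -
  have "min (Poly_Mapping.lookup m (Inl j)) (Poly_Mapping.lookup m (Inr k)) = 0"
    using assms(2) by auto
  then show ?thesis by (simp add: mcoeff_diag_series_times assms(1))
qed

section \<open>The infinite product over pairs of variables\<close>

definition active_pairs :: "(nat + nat \<Rightarrow>\<^sub>0 nat) \<Rightarrow> (nat \<times> nat) set" where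
  "active_pairs m = {(j, k). Poly_Mapping.lookup m (Inl j) \<noteq> 0 \<and> Poly_Mapping.lookup m (Inr k) \<noteq> 0}"

text \<open>The infinite product, built coefficient by coefficient: at \<open>m\<close> only the
  pairs active in \<open>m\<close> can matter, so the finite product over them already has the
  limiting value.\<close>

definition diag_prod :: "(nat \<Rightarrow> 'k::comm_ring_1) \<Rightarrow> (nat + nat, 'k) mfps" where
  "diag_prod c = Abs_mfps (\<lambda>m. mcoeff (\<Prod>(j, k)\<in>active_pairs m. diag_series c j k) m)"

lemma finite_active_pairs [simp]: "finite (active_pairs m)"
proof -
  have "active_pairs m = Inl -` Poly_Mapping.keys m \<times> Inr -` Poly_Mapping.keys m"
    by (auto simp: active_pairs_def in_keys_iff)
  then show ?thesis by (simp add: finite_vimageI)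
qed

lemma mcoeff_diag_prod:
  assumes "c 0 = 1" "finite J" "active_pairs m \<subseteq> J"
  shows "mcoeff (\<Prod>(j, k)\<in>J. diag_series c j k) m = mcoeff (diag_prod c) m"
proof -
  \<comment> \<open>A finite superset consists of the active pairs and further inactive ones, which
    are added one at a time without changing the coefficient.\<close>
  have "mcoeff (\<Prod>(j, k)\<in>active_pairs m \<union> I. diag_series c j k) m = mcoeff (diag_prod c) m"
    if "finite I" "I \<inter> active_pairs m = {}" for I
    using that
  proof (induction I)
    case empty
    then show ?case by (simp add: diag_prod_def)
  next
    case (insert x I)
    obtain j k where x: "x = (j, k)" by (cases x)
    have "Poly_Mapping.lookup m (Inl j) = 0 \<or> Poly_Mapping.lookup m (Inr k) = 0"
      using insert.prems by (auto simp: active_pairs_def x)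
    moreover have "x \<notin> active_pairs m \<union> I"
      using insert by auto
    ultimately show ?case
      using insert by (simp add: x mcoeff_diag_series_times_trivial assms(1))
  qed
  from this[of "J - active_pairs m"] assms(2,3) show ?thesis
    by (simp add: Un_absorb1 Int_commute)
qed

lemma has_formal_prod_diag_prod:
  assumes "c 0 = 1"
  shows "has_formal_prod (\<lambda>(j, k). diag_series c j k) (diag_prod c)"
  unfolding has_formal_prod_def
proof
  fix m
  show "\<forall>\<^sub>F J in finite_subsets_at_top UNIV.
      mcoeff (\<Prod>(j, k)\<in>J. diag_series c j k) m = mcoeff (diag_prod c) m"
    unfolding eventually_finite_subsets_at_top
    by (intro exI[of _ "active_pairs m"]) (simp add: mcoeff_diag_prod assms)
qed

text \<open>Reduces convergence to an identity of coefficients. \<open>A i j\<close> may be any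
  finite set containing the indices that contribute in bidegree \<open>(i, j)\<close>; in the
  applications it is cut out by the degree of the basis vectors.\<close>

lemma has_completed_sumI:
  assumes "\<And>s. f s \<in> sym_fun_XY" "g \<in> sym_fun_XY"
    and A: "\<And>i j. finite (A i j)"
      "\<And>s \<mu>. mcoeff (f s) \<mu> \<noteq> 0 \<Longrightarrow>
        s \<in> A (mdeg (Poly_Mapping.map_key Inl \<mu>)) (mdeg (Poly_Mapping.map_key Inr \<mu>))"
    and sum: "\<And>\<mu>. mcoeff g \<mu> =
      (\<Sum>s\<in>A (mdeg (Poly_Mapping.map_key Inl \<mu>)) (mdeg (Poly_Mapping.map_key Inr \<mu>)). mcoeff (f s) \<mu>)"
  shows "has_completed_sum f g"
  unfolding has_completed_sum_def
proof (intro conjI allI)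
  fix i j
  have sub: "{s. bihom_part i j (f s) \<noteq> 0} \<subseteq> A i j"
  proof
    fix s assume "s \<in> {s. bihom_part i j (f s) \<noteq> 0}"
    then obtain \<mu> where "mcoeff (bihom_part i j (f s)) \<mu> \<noteq> 0"
      using mfps_eqI[of "bihom_part i j (f s)" 0] by (auto simp: zero_mfps.rep_eq)
    then show "s \<in> A i j"
      using A(2)[of s \<mu>] by (auto simp: bihom_part_def split: if_splits)
  qed
  then show "finite {s. bihom_part i j (f s) \<noteq> 0}"
    using A(1) by (rule finite_subset)
  have "(\<Sum>s | bihom_part i j (f s) \<noteq> 0. bihom_part i j (f s)) = (\<Sum>s\<in>A i j. bihom_part i j (f s))"
    using A(1) sub by (intro sum.mono_neutral_left) auto
  also have "\<dots> = bihom_part i j g"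
    by (rule mfps_eqI) (auto simp: mcoeff_sum bihom_part_def sum)
  finally show "(\<Sum>s | bihom_part i j (f s) \<noteq> 0. bihom_part i j (f s)) = bihom_part i j g" .
qed (use assms(1,2) in auto)

section \<open>Specialized complete symmetric functions\<close>

lemma sym_funI:
  assumes "\<And>\<pi> m. bij \<pi> \<Longrightarrow> mcoeff f (Poly_Mapping.map_key \<pi> m) = mcoeff f m"
    and "\<And>m. mcoeff f m \<noteq> 0 \<Longrightarrow> mdeg m \<le> d"
  shows "f \<in> sym_fun"
  using assms by (auto simp: sym_fun_def)

lemma sym_fun_add: "f \<in> sym_fun \<Longrightarrow> g \<in> sym_fun \<Longrightarrow> f + g \<in> sym_fun"
proof -
  assume f: "f \<in> sym_fun" and g: "g \<in> sym_fun"
  from f obtain d where d: "\<And>m. mcoeff f m \<noteq> 0 \<Longrightarrow> mdeg m \<le> d" by (auto simp: sym_fun_def)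
  from g obtain e where e: "\<And>m. mcoeff g m \<noteq> 0 \<Longrightarrow> mdeg m \<le> e" by (auto simp: sym_fun_def)
  show "f + g \<in> sym_fun"
  proof (rule sym_funI[of _ "max d e"])
    show "mdeg m \<le> max d e" if "mcoeff (f + g) m \<noteq> 0" for m
      using that d[of m] e[of m] by (cases "mcoeff f m = 0") (auto simp: mcoeff_simps)
  qed (use f g in \<open>auto simp: sym_fun_def mcoeff_simps\<close>)
qed

lemma sym_fun_mult:
  assumes f: "f \<in> sym_fun" and g: "g \<in> sym_fun"
  shows "f * g \<in> sym_fun"
proof -
  from f obtain d where d: "\<And>m. mcoeff f m \<noteq> 0 \<Longrightarrow> mdeg m \<le> d" by (auto simp: sym_fun_def)
  from g obtain e where e: "\<And>m. mcoeff g m \<noteq> 0 \<Longrightarrow> mdeg m \<le> e" by (auto simp: sym_fun_def)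
  have fs: "mcoeff f (Poly_Mapping.map_key \<pi> m) = mcoeff f m"
    and gs: "mcoeff g (Poly_Mapping.map_key \<pi> m) = mcoeff g m" if "bij \<pi>" for \<pi> m
    using that f g by (auto simp: sym_fun_def)
  show ?thesis
  proof (rule sym_funI[of _ "d + e"])
    fix m assume "mcoeff (f * g) m \<noteq> 0"
    then obtain p q where "p + q = m" "mcoeff f p \<noteq> 0" "mcoeff g q \<noteq> 0"
      unfolding times_mfps.rep_eq by (force simp: mem_splittings elim!: sum.not_neutral_contains_not_neutral)
    then show "mdeg m \<le> d + e"
      using d[of p] e[of q] by (auto simp: mdeg_add)
  next
    fix \<pi> :: "nat \<Rightarrow> nat" and m assume \<pi>: "bij \<pi>"
    let ?k = "Poly_Mapping.map_key \<pi> :: (nat \<Rightarrow>\<^sub>0 nat) \<Rightarrow> _"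
    let ?k' = "Poly_Mapping.map_key (inv_into UNIV \<pi>) :: (nat \<Rightarrow>\<^sub>0 nat) \<Rightarrow> _"
    have \<pi>': "inj \<pi>" "inj (inv_into UNIV \<pi>)" using \<pi> by (auto simp: bij_is_inj bij_imp_bij_inv)
    \<comment> \<open>Relabelling variables is additive and invertible, so it carries the splittings
      of \<open>m\<close> bijectively to those of \<open>?k m\<close>.\<close>
    show "mcoeff (f * g) (?k m) = mcoeff (f * g) m"
      unfolding times_mfps.rep_eq
      by (rule sum.reindex_bij_witness[where i = "map_prod ?k ?k" and j = "map_prod ?k' ?k'"])
         (use \<pi> \<pi>' in \<open>auto simp: mem_splittings map_key_inverse map_key_plus[symmetric]
            bij_imp_bij_inv fs gs\<close>)
  qed
qed

lemma sym_fun_complete_sym: "complete_sym n \<in> sym_fun"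
  by (rule sym_funI[of _ n]) (auto simp: complete_sym_def mdeg_map_key split: if_splits)

lemma map_key_eq_single_iff:
  fixes \<pi> :: "'i \<Rightarrow> 'i"
  assumes "bij \<pi>"
  shows "(\<exists>i. Poly_Mapping.map_key \<pi> m = Poly_Mapping.single i n) \<longleftrightarrow> (\<exists>i. m = Poly_Mapping.single i n)"
proof
  have \<pi>': "inj \<pi>" "inj (inv_into UNIV \<pi>)" using assms by (auto simp: bij_is_inj bij_imp_bij_inv)
  {
    assume "\<exists>i. Poly_Mapping.map_key \<pi> m = Poly_Mapping.single i n"
    \<comment> \<open>Writing the index as the inverse image of \<open>\<pi> i\<close> puts the
      monomial into the shape that \<open>map_key_single\<close> can evaluate.\<close>
    then obtain i where "Poly_Mapping.map_key \<pi> m = Poly_Mapping.single (inv_into UNIV \<pi> (\<pi> i)) n"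
      using \<pi>' by auto
    then have "m = Poly_Mapping.map_key (inv_into UNIV \<pi>) (Poly_Mapping.single (inv_into UNIV \<pi> (\<pi> i)) n)"
      using map_key_inverse(2)[OF assms, of m] by simp
    then show "\<exists>i. m = Poly_Mapping.single i n"
      by (metis map_key_single \<pi>'(2))
  }
  assume "\<exists>i. m = Poly_Mapping.single i n"
  then obtain i where "m = Poly_Mapping.single (\<pi> (inv_into UNIV \<pi> i)) n"
    using assms by (auto simp: bij_is_surj surj_f_inv_f)
  then show "\<exists>i. Poly_Mapping.map_key \<pi> m = Poly_Mapping.single i n"
    by (metis map_key_single \<pi>'(1))
qed

lemma sym_fun_power_sum: "power_sum n \<in> sym_fun"
  by (rule sym_funI[of _ n]) (auto simp: power_sum_def map_key_eq_single_iff split: if_splits)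

lemma single_inj_left:
  assumes "Poly_Mapping.single x n = Poly_Mapping.single y n" "n \<noteq> 0"
  shows "x = y"
  using assms(2) arg_cong[OF assms(1), of Poly_Mapping.keys] by simp

text \<open>For \<open>i \<ge> 1\<close> the \<open>i\<close>-th powers of different variables are
  different monomials, and one that divides \<open>m\<close> has its variable in the support of
  \<open>m\<close>. Both fail for \<open>i = 0\<close>.\<close>

lemma mcoeff_power_sum_times:
  fixes f :: "(nat, 'a::comm_ring_1) mfps"
  assumes "i \<ge> 1"
  shows "mcoeff (power_sum i * f) m =
    (\<Sum>x | x \<in> Poly_Mapping.keys m \<and> i \<le> Poly_Mapping.lookup m x.
       mcoeff f (m - Poly_Mapping.single x i))"
proof -
  let ?X = "{x. x \<in> Poly_Mapping.keys m \<and> i \<le> Poly_Mapping.lookup m x}"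
  let ?s = "\<lambda>x. (Poly_Mapping.single x i, m - Poly_Mapping.single x i)"
  have [simp]: "mcoeff (power_sum i :: (nat, 'a) mfps) (Poly_Mapping.single x i) = 1" for x
    by (auto simp: power_sum_def)
  have "mcoeff (power_sum i * f) m =
      (\<Sum>(p, q)\<in>?s ` ?X. mcoeff (power_sum i) p * mcoeff f q)"
    unfolding times_mfps.rep_eq
  proof (rule sum.mono_neutral_right)
    show "?s ` ?X \<subseteq> splittings m"
      by (auto simp: mem_splittings single_plus_eq_iff)
    show "\<forall>s\<in>splittings m - ?s ` ?X. (case s of (p, q) \<Rightarrow> mcoeff (power_sum i) p * mcoeff f q) = 0"
    proof clarify
      fix p q assume s: "(p, q) \<in> splittings m" "(p, q) \<notin> ?s ` ?X"
      have "p \<noteq> Poly_Mapping.single x i" for x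
      proof
        assume p: "p = Poly_Mapping.single x i"
        then have "i \<le> Poly_Mapping.lookup m x" "q = m - Poly_Mapping.single x i"
          using s(1) by (simp_all add: mem_splittings single_plus_eq_iff)
        then show False using s(2) assms by (auto simp: p in_keys_iff)
      qed
      then show "mcoeff (power_sum i) p * mcoeff f q = 0"
        by (simp add: power_sum_def)
    qed
  qed simp
  also have "\<dots> = (\<Sum>x\<in>?X. mcoeff f (m - Poly_Mapping.single x i))"
    using assms
    by (subst sum.reindex) (auto simp: inj_on_def dest!: single_inj_left)
  finally show ?thesis .
qed

text \<open>On the right, the coefficient of a monomial of degree \<open>n\<close> counts the pairs
  of a variable \<open>x\<close> and an \<open>i \<ge> 1\<close> such that the \<open>i\<close>-th
  power of \<open>x\<close> divides it. Each variable contributes its exponent, which adds up to the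
  degree.\<close>

lemma newton_identity:
  "mfps_const (of_nat n) * complete_sym n =
     (\<Sum>i = 1..n. power_sum i * (complete_sym (n - i) :: (nat, 'k::comm_ring_1) mfps))"
proof (rule mfps_eqI)
  fix m :: "nat \<Rightarrow>\<^sub>0 nat"
  let ?K = "Poly_Mapping.keys m" and ?l = "Poly_Mapping.lookup m"
  \<comment> \<open>The bound \<open>i \<le> n\<close> is needed because \<open>n - i\<close> is
    truncated.\<close>
  have deg: "mdeg (m - Poly_Mapping.single x i) = n - i \<longleftrightarrow> mdeg m = n"
    if "i \<le> ?l x" "i \<le> n" for x i
  proof -
    have "Poly_Mapping.single x i + (m - Poly_Mapping.single x i) = m"
      using that by (simp add: single_plus_eq_iff)
    then have "mdeg m = i + mdeg (m - Poly_Mapping.single x i)"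
      by (metis mdeg_add mdeg_single)
    then show ?thesis using that by linarith
  qed
  have "mcoeff (\<Sum>i = 1..n. power_sum i * complete_sym (n - i)) m =
      (\<Sum>i = 1..n. \<Sum>x | x \<in> ?K \<and> i \<le> ?l x. if mdeg m = n then 1 else (0 :: 'k))"
    unfolding mcoeff_sum
    by (intro sum.cong refl) (auto simp: mcoeff_power_sum_times complete_sym_def deg intro!: sum.cong)
  also have "\<dots> = (if mdeg m = n then of_nat n else 0)"
  proof (cases "mdeg m = n")
    case True
    have le: "?l x \<le> n" if "x \<in> ?K" for x
      using that True member_le_sum[of x ?K ?l] by (simp add: mdeg_def)
    \<comment> \<open>The pairs are counted in the natural numbers, where swapping the sums leaves
      an interval of length \<open>?l x\<close> for each \<open>x\<close>; the count is cast into
      the ring afterwards.\<close>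
    have "(\<Sum>i = 1..n. \<Sum>x | x \<in> ?K \<and> i \<le> ?l x. 1 :: nat) = (\<Sum>x\<in>?K. \<Sum>i | i \<in> {1..n} \<and> i \<le> ?l x. 1)"
      by (rule sum.swap_restrict) auto
    also have "\<dots> = (\<Sum>x\<in>?K. ?l x)"
    proof (rule sum.cong[OF refl])
      fix x assume "x \<in> ?K"
      then have "{i. i \<in> {1..n} \<and> i \<le> ?l x} = {1..?l x}"
        using le by force
      then show "(\<Sum>i | i \<in> {1..n} \<and> i \<le> ?l x. 1) = ?l x" by simp
    qed
    also have "\<dots> = n" using True by (simp add: mdeg_def)
    finally have "of_nat (\<Sum>i = 1..n. \<Sum>x | x \<in> ?K \<and> i \<le> ?l x. 1) = (of_nat n :: 'k)"
      by simp
    then show ?thesis using True by simp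
  qed simp
  also have "\<dots> = mcoeff (mfps_const (of_nat n) * complete_sym n) m"
    by (simp add: mcoeff_const_times complete_sym_def)
  finally show "mcoeff (mfps_const (of_nat n) * complete_sym n) m =
      mcoeff (\<Sum>i = 1..n. power_sum i * (complete_sym (n - i) :: (nat, 'k) mfps)) m" ..
qed

context power_sum_specialization
begin

lemma kappa_complete_sym_0: "\<kappa> (complete_sym 0) = 1"
proof -
  have "complete_sym 0 = (1 :: (nat, 'k) mfps)"
    by (rule mfps_eqI) (simp add: complete_sym_def one_mfps.rep_eq mdeg_eq_0_iff)
  then show ?thesis by (simp add: kappa_one)
qed

text \<open>Membership and value are proved together because additivity of \<open>\<kappa>\<close>
  is available only inside \<open>sym_fun\<close>.\<close>

lemma kappa_sum:
  assumes "finite A" "\<And>i. i \<in> A \<Longrightarrow> f i \<in> sym_fun"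
  shows "(\<Sum>i\<in>A. f i) \<in> sym_fun \<and> \<kappa> (\<Sum>i\<in>A. f i) = (\<Sum>i\<in>A. \<kappa> (f i))"
  using assms
proof (induction A)
  case empty
  \<comment> \<open>The value at 0 comes from homogeneity, by writing 0 as a zero multiple of a
    power sum.\<close>
  have 0: "mfps_const 0 * power_sum 1 = (0 :: (nat, 'k) mfps)"
    by (rule mfps_eqI) (simp add: mcoeff_const_times zero_mfps.rep_eq)
  have "\<kappa> 0 = 0"
    using kappa_scale[OF sym_fun_power_sum, of 0 1] unfolding 0 by simp
  moreover have "(0 :: (nat, 'k) mfps) \<in> sym_fun"
    by (rule sym_funI) (auto simp: zero_mfps.rep_eq)
  ultimately show ?case by simp
next
  case (insert i A)
  then show ?case by (simp add: sym_fun_add kappa_add)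
qed

text \<open>The image of Newton's identity under the homomorphism. With value 1 at
  \<open>n = 0\<close> it is the recursion that drives the commutation relation of \<open>D\<close>
  and \<open>U\<close>.\<close>

lemma kappa_newton:
  "of_nat n * \<kappa> (complete_sym n) = (\<Sum>i = 1..n. a (int i) * \<kappa> (complete_sym (n - i)))"
proof -
  have "of_nat n * \<kappa> (complete_sym n) = \<kappa> (\<Sum>i = 1..n. power_sum i * complete_sym (n - i))"
    by (simp only: newton_identity[symmetric] kappa_scale sym_fun_complete_sym)
  also have "\<dots> = (\<Sum>i = 1..n. \<kappa> (power_sum i * complete_sym (n - i)))"
    by (rule conjunct2[OF kappa_sum])
       (auto intro: sym_fun_mult sym_fun_power_sum sym_fun_complete_sym)
  also have "\<dots> = (\<Sum>i = 1..n. a (int i) * \<kappa> (complete_sym (n - i)))"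
    by (rule sum.cong) (simp_all add: kappa_mult kappa_power_sum sym_fun_power_sum sym_fun_complete_sym)
  finally show ?thesis .
qed

end

section \<open>Partition sums of commuting operators\<close>

lemma foldr_mset_cong:
  assumes "mset xs = mset ys"
    and "\<And>x y. x \<in> set xs \<Longrightarrow> y \<in> set xs \<Longrightarrow> f x \<circ> f y = f y \<circ> f x"
  shows "foldr f xs = foldr f ys"
  unfolding foldr_conv_fold by (rule fold_multiset_equiv) (use assms in auto)

section \<open>Partitions and their weights\<close>

lemma finite_partitions [simp]: "finite (partitions n)"
proof (rule finite_subset)
  have len: "length \<mu> \<le> sum_list \<mu>" if "0 \<notin> set \<mu>" for \<mu> :: "nat list"
    using that by (induction \<mu>) auto
  show "partitions n \<subseteq> {\<mu>. set \<mu> \<subseteq> {..n} \<and> length \<mu> \<le> n}"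
    using len by (auto simp: partitions_def member_le_sum_list)
qed (simp add: finite_lists_length_le)

lemma partitions_0: "partitions 0 = {[]}"
proof -
  have "\<mu> = []" if "0 \<notin> set \<mu>" "sum_list \<mu> = 0" for \<mu> :: "nat list"
    using that by (cases \<mu>) auto
  then show ?thesis by (auto simp: partitions_def)
qed

lemma zee_eq_prod:
  assumes "finite A" "set \<mu> \<subseteq> A"
  shows "zee \<mu> = (\<Prod>i\<in>A. i ^ count_list \<mu> i * fact (count_list \<mu> i))"
  unfolding zee_def using assms by (intro prod.mono_neutral_left) (auto simp: count_list_0_iff)

text \<open>Dropping one of \<open>k\<close> copies of \<open>i\<close> divides the factor
  \<open>i ^ k * fact k\<close> by \<open>k * i\<close> and leaves all other factors alone.\<close>

lemma zee_remove1:
  assumes "i \<in> set \<mu>"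
  shows "zee \<mu> = zee (remove1 i \<mu>) * (count_list \<mu> i * i)"
proof -
  obtain k where k: "count_list \<mu> i = Suc k"
    using assms by (metis count_list_0_iff not0_implies_Suc)
  have "zee (remove1 i \<mu>) = (\<Prod>j\<in>set \<mu>. j ^ count_list (remove1 i \<mu>) j * fact (count_list (remove1 i \<mu>) j))"
    by (rule zee_eq_prod) (use set_remove1_subset[of i \<mu>] in auto)
  also have "\<dots> = i ^ k * fact k * (\<Prod>j\<in>set \<mu> - {i}. j ^ count_list \<mu> j * fact (count_list \<mu> j))"
    using assms by (subst prod.remove[of _ i]) (auto simp: count_list_remove1 k intro!: prod.cong)
  moreover have "zee \<mu> = i ^ Suc k * fact (Suc k) * (\<Prod>j\<in>set \<mu> - {i}. j ^ count_list \<mu> j * fact (count_list \<mu> j))"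
    unfolding zee_def using assms by (subst prod.remove[of _ i]) (auto simp: k)
  ultimately show ?thesis by (simp add: k algebra_simps)
qed

lemma sorted_wrt_remove1: "sorted_wrt R xs \<Longrightarrow> sorted_wrt R (remove1 x xs)"
  by (induction xs) (auto dest: subsetD[OF set_remove1_subset])

text \<open>The inverse inserts \<open>i\<close> and sorts again; a partition is determined by its
  multiset of parts. This is the double count behind Newton's recursion for operators.\<close>

lemma bij_betw_partitions_remove1:
  "bij_betw (\<lambda>(\<mu>, i). (i, remove1 i \<mu>)) (SIGMA \<mu>:partitions n. set \<mu>)
     (SIGMA i:{1..n}. partitions (n - i))"
proof (rule bij_betw_imageI)
  have sum: "sum_list (remove1 i \<mu>) = sum_list \<mu> - i" "i \<le> sum_list \<mu>" if "i \<in> set \<mu>" for i :: nat and \<mu>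
    using sum_list_map_remove1[OF that, of id] that by (auto simp: member_le_sum_list)
  have unique: "\<mu> = \<nu>" if "sorted_wrt (\<ge>) \<mu>" "sorted_wrt (\<ge>) \<nu>" "mset \<mu> = mset \<nu>" for \<mu> \<nu> :: "nat list"
  proof -
    have "sorted (rev \<mu>)" "sorted (rev \<nu>)"
      using that(1,2) by (simp_all add: sorted_wrt_rev)
    then have "rev \<mu> = rev \<nu>"
      using that(3) by (metis mset_rev properties_for_sort)
    then show ?thesis by simp
  qed
  show "inj_on (\<lambda>(\<mu>, i). (i, remove1 i \<mu>)) (SIGMA \<mu>:partitions n. set \<mu>)"
  proof (clarsimp simp: inj_on_def)
    fix \<mu> \<nu> i
    assume *: "\<mu> \<in> partitions n" "\<nu> \<in> partitions n" "i \<in> set \<mu>" "i \<in> set \<nu>" "remove1 i \<mu> = remove1 i \<nu>"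
    then have "mset \<mu> = mset \<nu>"
      by (metis mset_remove1 insert_DiffM set_mset_mset)
    then show "\<mu> = \<nu>" using * unique by (auto simp: partitions_def)
  qed
  show "(\<lambda>(\<mu>, i). (i, remove1 i \<mu>)) ` (SIGMA \<mu>:partitions n. set \<mu>) =
      (SIGMA i:{1..n}. partitions (n - i))"
  proof (intro equalityI subsetI)
    fix x assume "x \<in> (\<lambda>(\<mu>, i). (i, remove1 i \<mu>)) ` (SIGMA \<mu>:partitions n. set \<mu>)"
    then obtain \<mu> i where x: "x = (i, remove1 i \<mu>)" and \<mu>: "\<mu> \<in> partitions n" and i: "i \<in> set \<mu>"
      by auto
    have "sorted_wrt (\<ge>) (remove1 i \<mu>)"
      using \<mu> by (intro sorted_wrt_remove1) (simp add: partitions_def)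
    then show "x \<in> (SIGMA i:{1..n}. partitions (n - i))"
      using \<mu> i sum[OF i] set_remove1_subset[of i \<mu>]
      by (auto simp: x partitions_def Suc_le_eq intro: gr0I)
  next
    fix x assume "x \<in> (SIGMA i:{1..n}. partitions (n - i))"
    then obtain i \<nu> where x: "x = (i, \<nu>)" and i: "1 \<le> i" "i \<le> n" and \<nu>: "\<nu> \<in> partitions (n - i)"
      by auto
    \<comment> \<open>\<open>sort\<close> is increasing while partitions are decreasing, hence
      \<open>rev\<close>.\<close>
    define \<mu> where "\<mu> = rev (sort (i # \<nu>))"
    have m: "mset \<mu> = mset (i # \<nu>)" by (simp add: \<mu>_def)
    then have set: "set \<mu> = insert i (set \<nu>)" by (metis list.set(2) mset_eq_setD)
    have "sum_list \<mu> = i + sum_list \<nu>"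
      using m by (metis sum_list.Cons sum_mset_sum_list)
    moreover have "sorted_wrt (\<ge>) \<mu>" by (simp add: \<mu>_def sorted_wrt_rev del: sort_key_simps)
    ultimately have \<mu>: "\<mu> \<in> partitions n" using i \<nu> set by (auto simp: partitions_def)
    have "sorted_wrt (\<ge>) (remove1 i \<mu>)"
      using \<open>sorted_wrt (\<ge>) \<mu>\<close> by (rule sorted_wrt_remove1)
    then have "remove1 i \<mu> = \<nu>"
      using \<nu> m by (intro unique) (auto simp: partitions_def)
    then show "x \<in> (\<lambda>(\<mu>, i). (i, remove1 i \<mu>)) ` (SIGMA \<mu>:partitions n. set \<mu>)"
      using \<mu> set by (auto simp: x intro!: image_eqI[of _ _ "(\<mu>, i)"])
  qed
qed

section \<open>Newton's recursion for commuting operators\<close>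

lemma linear_comp_apply:
  "Vector_Spaces.linear s t f \<Longrightarrow> Vector_Spaces.linear t u g \<Longrightarrow>
    Vector_Spaces.linear s u (\<lambda>x. g (f x))"
  using Vector_Spaces.linear_compose[of s t f u g] by (simp add: comp_def)

lemmas linear_sum_apply = module_hom.sum[OF linear_iff_module_hom[THEN iffD1]]
  and linear_scale_apply = module_hom.scale[OF linear_iff_module_hom[THEN iffD1]]
  and linear_add_apply = module_hom.add[OF linear_iff_module_hom[THEN iffD1]]
  and linear_zero_apply = module_hom.zero[OF linear_iff_module_hom[THEN iffD1]]

text \<open>Treats \<open>D\<close> and \<open>U\<close> at once: \<open>P i\<close> will be the
  Heisenberg generator of index \<open>i\<close> in one case and of index \<open>- i\<close> in the
  other.\<close>

locale commuting_operators = vector_space scale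
  for scale :: "'k::field_char_0 \<Rightarrow> 'v::ab_group_add \<Rightarrow> 'v" +
  fixes P :: "nat \<Rightarrow> 'v \<Rightarrow> 'v"
  assumes P_linear: "i > 0 \<Longrightarrow> Vector_Spaces.linear scale scale (P i)"
    and P_commute: "i > 0 \<Longrightarrow> j > 0 \<Longrightarrow> P i (P j w) = P j (P i w)"
begin

text \<open>The operator obtained from the power sum expansion of \<open>h_n\<close> by substituting
  \<open>P i\<close> for \<open>p_i\<close>.\<close>

definition partition_sum :: "nat \<Rightarrow> 'v \<Rightarrow> 'v" where
  "partition_sum n w = (\<Sum>\<mu>\<in>partitions n. scale (inverse (of_nat (zee \<mu>))) (foldr P \<mu> w))"

lemma linear_foldr: "0 \<notin> set \<mu> \<Longrightarrow> Vector_Spaces.linear scale scale (foldr P \<mu>)"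
proof (induction \<mu>)
  case Nil
  then show ?case using linear_id by (simp add: id_def)
next
  case (Cons i \<mu>)
  then have "Vector_Spaces.linear scale scale (\<lambda>w. P i (foldr P \<mu> w))"
    by (intro linear_comp_apply[where f = "foldr P \<mu>" and g = "P i", OF _ P_linear]) auto
  then show ?case by (simp add: comp_def)
qed

lemma linear_partition_sum: "Vector_Spaces.linear scale scale (partition_sum n)"
proof -
  interpret vector_space_pair scale scale ..
  have "Vector_Spaces.linear scale scale (foldr P \<mu>)" if "\<mu> \<in> partitions n" for \<mu>
    using that by (intro linear_foldr) (simp add: partitions_def)
  then show ?thesis
    unfolding partition_sum_def[abs_def]
    by (intro linear_compose_sum ballI linear_compose_scale_right) auto
qed

lemma partition_sum_0 [simp]: "partition_sum 0 w = w"
  by (simp add: partition_sum_def partitions_0 zee_def)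

text \<open>
  Count pairs of a partition and one of its distinct parts, weighting a part by its total
  contribution to \<open>n\<close>.
\<close>

lemma partition_sum_newton:
  "scale (of_nat n) (partition_sum n w) = (\<Sum>i = 1..n. P i (partition_sum (n - i) w))"
proof -
  let ?z = "\<lambda>\<mu>. inverse (of_nat (zee \<mu>)) :: 'k"
  have "(\<Sum>i = 1..n. P i (partition_sum (n - i) w)) =
      (\<Sum>i = 1..n. \<Sum>\<mu>\<in>partitions (n - i). scale (?z \<mu>) (P i (foldr P \<mu> w)))"
    unfolding partition_sum_def
    by (intro sum.cong refl) (simp add: linear_sum_apply[OF P_linear] linear_scale_apply[OF P_linear])
  also have "\<dots> = (\<Sum>(i, \<mu>)\<in>(SIGMA i:{1..n}. partitions (n - i)). scale (?z \<mu>) (P i (foldr P \<mu> w)))"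
    by (rule sum.Sigma) auto
  also have "\<dots> = (\<Sum>(\<mu>, i)\<in>(SIGMA \<mu>:partitions n. set \<mu>).
      scale (?z (remove1 i \<mu>)) (P i (foldr P (remove1 i \<mu>) w)))"
    using sum.reindex_bij_betw[OF bij_betw_partitions_remove1[of n],
        of "\<lambda>(i, \<mu>). scale (?z \<mu>) (P i (foldr P \<mu> w))", symmetric]
    by (simp only: case_prod_unfold fst_conv snd_conv)
  also have "\<dots> = (\<Sum>\<mu>\<in>partitions n. \<Sum>i\<in>set \<mu>.
      scale (?z (remove1 i \<mu>)) (P i (foldr P (remove1 i \<mu>) w)))"
    by (rule sum.Sigma[symmetric]) auto
  also have "\<dots> = (\<Sum>\<mu>\<in>partitions n. scale (of_nat n) (scale (?z \<mu>) (foldr P \<mu> w)))"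
  proof (rule sum.cong[OF refl])
    fix \<mu> assume \<mu>: "\<mu> \<in> partitions n"
    have "scale (?z (remove1 i \<mu>)) (P i (foldr P (remove1 i \<mu>) w)) =
        scale (of_nat (count_list \<mu> i * i)) (scale (?z \<mu>) (foldr P \<mu> w))" if i: "i \<in> set \<mu>" for i
    proof -
      \<comment> \<open>By commutativity the removed part may be put back at the front instead of at
        its sorted position.\<close>
      have "foldr P (i # remove1 i \<mu>) = foldr P \<mu>"
      proof (rule foldr_mset_cong)
        have "set (i # remove1 i \<mu>) \<subseteq> set \<mu>"
          using i set_remove1_subset[of i \<mu>] by auto
        moreover have "0 \<notin> set \<mu>" using \<mu> by (simp add: partitions_def)
        ultimately show "P x \<circ> P y = P y \<circ> P x"
          if "x \<in> set (i # remove1 i \<mu>)" "y \<in> set (i # remove1 i \<mu>)" for x y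
          using that P_commute[of x y] by (auto simp: fun_eq_iff intro!: P_commute gr0I)
      qed (use i in simp)
      then have "P i (foldr P (remove1 i \<mu>) w) = foldr P \<mu> w"
        by (metis comp_apply foldr_Cons)
      moreover have "?z (remove1 i \<mu>) = of_nat (count_list \<mu> i * i) * ?z \<mu>"
      proof -
        define k where "k = count_list \<mu> i * i"
        \<comment> \<open>In characteristic 0 a positive part with positive multiplicity has an
          invertible weight, so the relation between the two values of \<open>zee\<close> can be
          inverted.\<close>
        have "i \<noteq> 0"
          using i \<mu> by (metis (mono_tags, lifting) mem_Collect_eq partitions_def)
        then have "(of_nat k :: 'k) \<noteq> 0"
          using i by (simp add: k_def count_list_0_iff)
        moreover have "of_nat (zee \<mu>) = (of_nat (zee (remove1 i \<mu>)) * of_nat k :: 'k)"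
          unfolding k_def zee_remove1[OF i] of_nat_mult ..
        ultimately show ?thesis
          unfolding k_def[symmetric] by (simp add: inverse_mult_distrib)
      qed
      ultimately show ?thesis by (simp only: scale_scale)
    qed
    then have "(\<Sum>i\<in>set \<mu>. scale (?z (remove1 i \<mu>)) (P i (foldr P (remove1 i \<mu>) w))) =
        (\<Sum>i\<in>set \<mu>. scale (of_nat (count_list \<mu> i * i)) (scale (?z \<mu>) (foldr P \<mu> w)))"
      by (intro sum.cong) auto
    also have "\<dots> = scale (of_nat (\<Sum>i\<in>set \<mu>. count_list \<mu> i * i)) (scale (?z \<mu>) (foldr P \<mu> w))"
      by (simp only: scale_sum_left of_nat_sum)
    also have "(\<Sum>i\<in>set \<mu>. count_list \<mu> i * i) = n"
      using \<mu> sum_list_map_eq_sum_count[of id \<mu>] by (simp add: partitions_def)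
    finally show "(\<Sum>i\<in>set \<mu>. scale (?z (remove1 i \<mu>)) (P i (foldr P (remove1 i \<mu>) w))) =
        scale (of_nat n) (scale (?z \<mu>) (foldr P \<mu> w))" .
  qed
  also have "\<dots> = scale (of_nat n) (partition_sum n w)"
    by (simp only: partition_sum_def scale_sum_right)
  finally show ?thesis ..
qed

lemma commute_partition_sum:
  assumes "Vector_Spaces.linear scale scale T" "\<And>i w. i > 0 \<Longrightarrow> T (P i w) = P i (T w)"
  shows "T (partition_sum n w) = partition_sum n (T w)"
proof -
  have "T (foldr P \<mu> w) = foldr P \<mu> (T w)" if "0 \<notin> set \<mu>" for \<mu>
    using that by (induction \<mu>) (simp_all add: assms(2))
  then show ?thesis
    unfolding partition_sum_def
    by (auto simp: linear_sum_apply[OF assms(1)] linear_scale_apply[OF assms(1)] partitions_def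
        intro!: sum.cong)
qed

text \<open>Two uses of \<open>commute_partition_sum\<close>: each \<open>P i\<close> commutes with
  every partition sum, and therefore partition sums commute with one another. The symmetry of
  \<open>F\<close> and \<open>G\<close> rests on this.\<close>

lemma partition_sum_commute: "partition_sum n (partition_sum l w) = partition_sum l (partition_sum n w)"
proof (rule commute_partition_sum[OF linear_partition_sum])
  fix i :: nat and w assume "i > 0"
  then show "partition_sum n (P i w) = P i (partition_sum n w)"
    by (intro commute_partition_sum[symmetric] P_linear P_commute)
qed

end

section \<open>The commutation relation\<close>

locale heisenberg_operators = vector_space scale
  for scale :: "'k::field_char_0 \<Rightarrow> 'v::ab_group_add \<Rightarrow> 'v" +
  fixes B :: "int \<Rightarrow> 'v \<Rightarrow> 'v" and a :: "int \<Rightarrow> 'k"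
  assumes B_linear: "k \<noteq> 0 \<Longrightarrow> Vector_Spaces.linear scale scale (B k)"
    and B_commutator: "k \<noteq> 0 \<Longrightarrow> l \<noteq> 0 \<Longrightarrow>
      B k (B l w) = B l (B k w) + scale (if k = - l then of_int k * a k else 0) w"
begin

sublocale D: commuting_operators scale "\<lambda>i. B (int i)"
proof (intro commuting_operators.intro vector_space_axioms commuting_operators_axioms.intro)
  \<comment> \<open>The central term occurs only for opposite indices, so generators of one sign
    commute.\<close>
  show "B (int i) (B (int j) w) = B (int j) (B (int i) w)" if "i > 0" "j > 0" for i j w
    using that by (subst B_commutator) auto
qed (simp add: B_linear)

sublocale U: commuting_operators scale "\<lambda>i. B (- int i)"
proof (intro commuting_operators.intro vector_space_axioms commuting_operators_axioms.intro)
  show "B (- int i) (B (- int j) w) = B (- int j) (B (- int i) w)" if "i > 0" "j > 0" for i j w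
    using that by (subst B_commutator) auto
qed (simp add: B_linear)

abbreviation "D \<equiv> D.partition_sum"
abbreviation "U \<equiv> U.partition_sum"

text \<open>Strong induction on \<open>n\<close>. In \<open>n U_n = \<Sum> B_{-j} U_{n-j}\<close>
  the commutator of \<open>B_i\<close> with \<open>B_{-i}\<close> yields
  \<open>i a_i U_{n-i}\<close>, the induction hypothesis yields
  \<open>a_i \<Sum> B_{-j} U_{n-i-j} = (n - i) a_i U_{n-i}\<close>, and the total factor
  \<open>n\<close> cancels.\<close>

lemma B_U:
  assumes i: "i > 0"
  shows "B (int i) (U n w) = U n (B (int i) w) + (if i \<le> n then scale (a (int i)) (U (n - i) w) else 0)"
proof (induction n arbitrary: w rule: less_induct)
  case (less n)
  show ?case
  proof (cases "n = 0")
    case False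
    let ?b = "\<lambda>n w. if i \<le> n then scale (a (int i)) (U (n - i) w) else 0"
    have Bi: "Vector_Spaces.linear scale scale (B (int i))" using i by (simp add: B_linear)
    have Bj: "Vector_Spaces.linear scale scale (B (- int j))" if "j \<in> {1..n}" for j
      using that by (simp add: B_linear)
    have "scale (of_nat n) (B (int i) (U n w)) = B (int i) (scale (of_nat n) (U n w))"
      by (simp add: linear_scale_apply[OF Bi])
    also have "\<dots> = (\<Sum>j = 1..n. B (int i) (B (- int j) (U (n - j) w)))"
      by (simp add: U.partition_sum_newton linear_sum_apply[OF Bi])
    also have "\<dots> = (\<Sum>j = 1..n. B (- int j) (B (int i) (U (n - j) w)) +
        (if j = i then scale (of_nat i * a (int i)) (U (n - i) w) else 0))"
    proof (rule sum.cong[OF refl])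
      fix j assume "j \<in> {1..n}"
      then show "B (int i) (B (- int j) (U (n - j) w)) = B (- int j) (B (int i) (U (n - j) w)) +
          (if j = i then scale (of_nat i * a (int i)) (U (n - i) w) else 0)"
        using i by (subst B_commutator) auto
    qed
    also have "\<dots> = (\<Sum>j = 1..n. B (- int j) (U (n - j) (B (int i) w)) + B (- int j) (?b (n - j) w) +
        (if j = i then scale (of_nat i * a (int i)) (U (n - i) w) else 0))"
      by (intro sum.cong refl) (simp add: less.IH linear_add_apply[OF Bj])
    also have "\<dots> = scale (of_nat n) (U n (B (int i) w)) + (\<Sum>j = 1..n. B (- int j) (?b (n - j) w)) +
        (if i \<le> n then scale (of_nat i * a (int i)) (U (n - i) w) else 0)"
      using i by (simp add: sum.distrib U.partition_sum_newton sum.delta' Suc_le_eq)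
    \<comment> \<open>Terms with \<open>j > n - i\<close> vanish; the others form \<open>a_i\<close>
      times Newton's recursion at \<open>n - i\<close>.\<close>
    also have "(\<Sum>j = 1..n. B (- int j) (?b (n - j) w)) =
        (if i \<le> n then scale (of_nat (n - i) * a (int i)) (U (n - i) w) else 0)"
    proof (cases "i \<le> n")
      case True
      have "(\<Sum>j = 1..n. B (- int j) (?b (n - j) w)) =
          (\<Sum>j = 1..n - i. B (- int j) (scale (a (int i)) (U (n - i - j) w)))"
        by (rule sum.mono_neutral_cong_right)
           (use True in \<open>auto simp: linear_zero_apply[OF Bj] add.commute\<close>)
      also have "\<dots> = scale (a (int i)) (\<Sum>j = 1..n - i. B (- int j) (U (n - i - j) w))"
        unfolding scale_sum_right using True
        by (intro sum.cong refl linear_scale_apply[OF Bj]) auto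
      also have "\<dots> = scale (of_nat (n - i) * a (int i)) (U (n - i) w)"
        unfolding U.partition_sum_newton[symmetric] by (simp add: mult.commute)
      finally show ?thesis using True by simp
    next
      case False
      then have "\<not> i \<le> n - j" for j by simp
      then show ?thesis using False by (simp add: linear_zero_apply[OF Bj])
    qed
    also have "scale (of_nat n) (U n (B (int i) w)) +
        (if i \<le> n then scale (of_nat (n - i) * a (int i)) (U (n - i) w) else 0) +
        (if i \<le> n then scale (of_nat i * a (int i)) (U (n - i) w) else 0) =
        scale (of_nat n) (U n (B (int i) w) + ?b n w)"
      by (simp add: scale_right_distrib add.assoc scale_left_distrib[symmetric]
          distrib_right[symmetric] of_nat_add[symmetric] del: of_nat_add)
    finally show ?thesis using False by simp
  qed (use i in simp)
qed

text \<open>Induction on \<open>n\<close> through Newton's recursion for \<open>D\<close>. Moving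
  \<open>B_i\<close> past \<open>U_{l-k}\<close> with \<open>B_U\<close> gives two sums: the first
  recombines to \<open>(n - k) c_k\<close> by the recursion for \<open>D\<close>, the second to
  \<open>k c_k\<close> by the recursion for \<open>c\<close>. Together they give
  \<open>n c_k\<close>, and \<open>n\<close> cancels.\<close>

lemma D_U:
  assumes c0: "c 0 = 1"
    and c: "\<And>n. of_nat n * c n = (\<Sum>i = 1..n. a (int i) * c (n - i))"
  shows "D n (U l w) = (\<Sum>k\<le>min l n. scale (c k) (U (l - k) (D (n - k) w)))"
proof (induction n rule: less_induct)
  case (less n)
  show ?case
  proof (cases "n = 0")
    case False
    let ?X = "\<lambda>k. U (l - k) (D (n - k) w)"
    have Bi: "Vector_Spaces.linear scale scale (B (int i))" if "i \<in> {1..n}" for i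
      using that by (simp add: B_linear)
    have "scale (of_nat n) (D n (U l w)) = (\<Sum>i = 1..n. B (int i) (D (n - i) (U l w)))"
      by (rule D.partition_sum_newton)
    also have "\<dots> = (\<Sum>i = 1..n. \<Sum>k\<le>min l (n - i). scale (c k) (B (int i) (U (l - k) (D (n - i - k) w))))"
      by (intro sum.cong refl)
         (simp add: less.IH linear_sum_apply[OF Bi] linear_scale_apply[OF Bi])
    also have "\<dots> = (\<Sum>i = 1..n. \<Sum>k\<le>min l (n - i).
        scale (c k) (U (l - k) (B (int i) (D (n - i - k) w)))) +
        (\<Sum>i = 1..n. \<Sum>k\<le>min l (n - i). if i \<le> l - k then scale (a (int i) * c k) (?X (i + k)) else 0)"
      unfolding sum.distrib[symmetric]
      by (intro sum.cong refl) (auto simp: B_U scale_right_distrib add.commute mult.commute)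
    \<comment> \<open>Both orders of summation run over \<open>i \<ge> 1\<close>,
      \<open>k \<le> l\<close>, \<open>i + k \<le> n\<close>.\<close>
    also have "(\<Sum>i = 1..n. \<Sum>k\<le>min l (n - i). scale (c k) (U (l - k) (B (int i) (D (n - i - k) w)))) =
        (\<Sum>k\<le>min l n. \<Sum>i = 1..n - k. scale (c k) (U (l - k) (B (int i) (D (n - k - i) w))))"
      by (subst (1 2) sum.Sigma,
          simp, simp, simp, simp,
          rule sum.reindex_bij_witness[where i = prod.swap and j = prod.swap])
         (auto simp: add.commute)
    also have "\<dots> = (\<Sum>k\<le>min l n. scale (of_nat (n - k) * c k) (?X k))"
    proof (rule sum.cong[OF refl])
      fix k
      have "(\<Sum>i = 1..n - k. scale (c k) (U (l - k) (B (int i) (D (n - k - i) w)))) =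
          scale (c k) (U (l - k) (\<Sum>i = 1..n - k. B (int i) (D (n - k - i) w)))"
        by (simp add: linear_sum_apply[OF U.linear_partition_sum] scale_sum_right)
      then show "(\<Sum>i = 1..n - k. scale (c k) (U (l - k) (B (int i) (D (n - k - i) w)))) =
          scale (of_nat (n - k) * c k) (?X k)"
        unfolding D.partition_sum_newton[symmetric]
        by (simp add: linear_scale_apply[OF U.linear_partition_sum] mult.commute)
    qed
    \<comment> \<open>Since \<open>i \<ge> 1\<close>, the truncated condition
      \<open>i \<le> l - k\<close> means \<open>i + k \<le> l\<close>. The terms are then grouped by
      \<open>i + k\<close>, which is renamed \<open>k\<close>.\<close>
    also have "(\<Sum>i = 1..n. \<Sum>k\<le>min l (n - i).
        if i \<le> l - k then scale (a (int i) * c k) (?X (i + k)) else 0) =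
        (\<Sum>(i, k)\<in>{(i, k). 1 \<le> i \<and> i + k \<le> min l n}. scale (a (int i) * c k) (?X (i + k)))"
      by (subst sum.Sigma, simp, simp, rule sum.mono_neutral_cong_right) (auto split: if_splits)
    also have "\<dots> = (\<Sum>k\<le>min l n. \<Sum>i = 1..k. scale (a (int i) * c (k - i)) (?X k))"
      by (subst sum.Sigma, simp, simp,
          rule sum.reindex_bij_witness[where i = "\<lambda>(k, i). (i, k - i)" and j = "\<lambda>(i, k). (i + k, i)"])
         auto
    also have "\<dots> = (\<Sum>k\<le>min l n. scale (of_nat k * c k) (?X k))"
      by (simp add: c scale_sum_left)
    also have "(\<Sum>k\<le>min l n. scale (of_nat (n - k) * c k) (?X k)) +
        (\<Sum>k\<le>min l n. scale (of_nat k * c k) (?X k)) =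
        (\<Sum>k\<le>min l n. scale (of_nat n) (scale (c k) (?X k)))"
      unfolding sum.distrib[symmetric]
      by (intro sum.cong refl)
         (simp add: of_nat_diff scale_left_distrib[symmetric] left_diff_distrib)
    also have "\<dots> = scale (of_nat n) (\<Sum>k\<le>min l n. scale (c k) (?X k))"
      by (simp only: scale_sum_right)
    finally show ?thesis using False by simp
  qed (simp add: c0)
qed

end

section \<open>Heisenberg representations\<close>

lemma ring_of_type_algebra_ring: "ring (ring_of_type_algebra :: 'a::ring_1 ring)"
proof -
  have "\<exists>y. x + y = 0" for x :: 'a
    using add.right_inverse by blast
  then show ?thesis
    unfolding ring_of_type_algebra_def using add.right_inverse
    by unfold_locales (auto simp: algebra_simps Units_def)
qed

lemma heis_ideal: "ideal (heis_ideal a) (ring_of_type_algebra :: 'k::field_char_0 hfree ring)"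
  unfolding heis_ideal_def
  by (rule ring.genideal_ideal[OF ring_of_type_algebra_ring]) (simp add: ring_of_type_algebra_def)

lemma heis_class_hom:
  "heis_class a \<in> ring_hom (ring_of_type_algebra :: 'k::field_char_0 hfree ring) (heisenberg a)"
  using ideal.rcos_ring_hom[OF heis_ideal, of a]
  by (simp add: heisenberg_def heis_class_def[abs_def])

text \<open>The relator lies in the ideal, so its coset is the ideal itself, as is the coset of 0.
  An equation of cosets can be passed through \<open>act\<close>.\<close>

lemma heis_class_relation:
  assumes "k \<noteq> 0" "l \<noteq> 0"
  shows "heis_class a (hgen k * hgen l - hgen l * hgen k - hscalar (if k = - l then of_int k * a k else 0)) =
    heis_class (a :: int \<Rightarrow> 'k::field_char_0) 0"
proof -
  let ?R = "ring_of_type_algebra :: 'k hfree ring"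
  interpret ideal "heis_ideal a" ?R by (rule heis_ideal)
  have "heis_relations a \<subseteq> heis_ideal a"
    unfolding heis_ideal_def by (rule ring.genideal_self[OF ring_of_type_algebra_ring])
      (simp add: ring_of_type_algebra_def)
  then have "hgen k * hgen l - hgen l * hgen k - hscalar (if k = - l then of_int k * a k else 0) \<in> heis_ideal a"
    using assms unfolding heis_relations_def by blast
  moreover have "0 \<in> heis_ideal a"
    using additive_subgroup.zero_closed[OF additive_subgroup_axioms] by (simp add: ring_of_type_algebra_def)
  ultimately show ?thesis
    unfolding heis_class_def by (simp add: a_rcos_const)
qed

section \<open>Independence of the order of the variables\<close>

lemma fold_eq_on_support:
  assumes "distinct xs" "distinct ys" "K \<subseteq> set xs" "K \<subseteq> set ys"
    and id: "\<And>i w. i \<notin> K \<Longrightarrow> f i w = w"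
    and commute: "\<And>i j w. f i (f j w) = f j (f i w)"
  shows "fold f xs w = fold f ys w"
proof -
  have filter: "fold f zs w = fold f (filter (\<lambda>i. i \<in> K) zs) w" for zs w
    by (induction zs arbitrary: w) (simp_all add: id)
  \<comment> \<open>With the trivially acting indices deleted, both lists enumerate \<open>K\<close>
    without repetition.\<close>
  have "mset (filter (\<lambda>i. i \<in> K) xs) = mset (filter (\<lambda>i. i \<in> K) ys)"
    using assms(1-4) by (subst set_eq_iff_mset_eq_distinct[symmetric]) auto
  then have "fold f (filter (\<lambda>i. i \<in> K) xs) = fold f (filter (\<lambda>i. i \<in> K) ys)"
    by (intro fold_multiset_equiv) (auto simp: fun_eq_iff commute)
  then show ?thesis by (simp add: filter[of xs] filter[of ys])
qed

text \<open>Frees \<open>act_seq\<close> from its fixed enumeration of variables: any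
  repetition-free list covering the support will do. This serves permutations of the variables as
  well as a common range of variables for several monomials.\<close>

lemma act_seq_eq_fold:
  assumes "distinct xs" "Poly_Mapping.keys \<alpha> \<subseteq> set xs"
    and "\<And>w. act (E 0) w = w"
    and "\<And>m n w. act (E m) (act (E n) w) = act (E n) (act (E m) w)"
  shows "act_seq act E \<alpha> w = fold (\<lambda>i. act (E (Poly_Mapping.lookup \<alpha> i))) xs w"
  unfolding act_seq_def
  by (rule fold_eq_on_support[of _ _ "Poly_Mapping.keys \<alpha>"])
     (use assms in \<open>auto simp: in_keys_iff dest: Poly_Mapping.in_keys_less_degree\<close>)

lemma act_seq_map_key:
  assumes "bij \<pi>"
    and "\<And>w. act (E 0) w = w"
    and "\<And>m n w. act (E m) (act (E n) w) = act (E n) (act (E m) w)"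
  shows "act_seq act E (Poly_Mapping.map_key \<pi> \<alpha>) = act_seq act E \<alpha>"
proof
  fix w
  have inj: "inj \<pi>" using assms(1) by (rule bij_is_inj)
  have "finite (\<pi> -` Poly_Mapping.keys \<alpha>)"
    by (rule finite_vimageI[OF finite_keys inj])
  \<comment> \<open>\<open>xs\<close> enumerates the support after relabelling, so
    \<open>map \<pi> xs\<close> enumerates the original one.\<close>
  then obtain xs where xs: "set xs = \<pi> -` Poly_Mapping.keys \<alpha>" "distinct xs"
    using finite_distinct_list by blast
  have "act_seq act E (Poly_Mapping.map_key \<pi> \<alpha>) w =
      fold (\<lambda>i. act (E (Poly_Mapping.lookup \<alpha> (\<pi> i)))) xs w"
    by (subst act_seq_eq_fold[OF xs(2)]) (simp_all add: assms keys_map_key inj lookup_map_key xs(1))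
  also have "\<dots> = fold (\<lambda>i. act (E (Poly_Mapping.lookup \<alpha> i))) (map \<pi> xs) w"
    by (simp add: fold_map comp_def)
  also have "\<dots> = act_seq act E \<alpha> w"
  proof (rule act_seq_eq_fold[symmetric])
    show "distinct (map \<pi> xs)" using xs(2) inj_on_subset[OF inj] by (simp add: distinct_map)
    show "Poly_Mapping.keys \<alpha> \<subseteq> set (map \<pi> xs)"
      using assms(1) by (simp add: xs(1) surj_image_vimage_eq bij_is_surj)
  qed (use assms in auto)
  finally show "act_seq act E (Poly_Mapping.map_key \<pi> \<alpha>) w = act_seq act E \<alpha> w" .
qed

lemma linear_fold:
  assumes "vector_space s" "\<And>i. Vector_Spaces.linear s s (f i)"
  shows "Vector_Spaces.linear s s (fold f xs)"
proof (induction xs)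
  case Nil
  then show ?case using vector_space.linear_id[OF assms(1)] by (simp add: id_def)
next
  case (Cons i xs)
  then show ?case using linear_comp_apply[OF assms(2)] by (simp add: comp_def)
qed

section \<open>The representation pulled back to the free algebra\<close>

context graded_heisenberg_rep
begin

text \<open>In the free algebra sums and products are the ordinary ones, so the formulas defining
  \<open>heis_D\<close> and \<open>heis_U\<close> can be expanded without handling cosets.\<close>

definition rep :: "'k hfree \<Rightarrow> 'v \<Rightarrow> 'v" where
  "rep x = act (heis_class a x)"

lemma rep_hom: "rep \<in> ring_hom ring_of_type_algebra (End_ring scale)"
  using ring_hom_trans[OF heis_class_hom act_hom] by (simp add: rep_def[abs_def] comp_def)

lemma rep_linear: "Vector_Spaces.linear scale scale (rep x)"
  using ring_hom_closed[OF rep_hom, of x] by (simp add: ring_of_type_algebra_def End_ring_def)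

lemma rep_mult: "rep (x * y) w = rep x (rep y w)"
  using ring_hom_mult[OF rep_hom, of x y] by (simp add: ring_of_type_algebra_def End_ring_def)

lemma rep_add: "rep (x + y) w = rep x w + rep y w"
  using ring_hom_add[OF rep_hom, of x y] by (simp add: ring_of_type_algebra_def End_ring_def)

lemma rep_one: "rep 1 w = w"
  using ring_hom_one[OF rep_hom] by (simp add: ring_of_type_algebra_def End_ring_def)

lemma rep_zero: "rep 0 w = 0"
  using rep_add[of 0 0 w] by simp

lemma rep_diff: "rep (x - y) w = rep x w - rep y w"
  using rep_add[of "x - y" y w] by (simp add: algebra_simps)

lemma rep_sum: "rep (\<Sum>i\<in>I. f i) w = (\<Sum>i\<in>I. rep (f i) w)"
  by (induction I rule: infinite_finite_induct) (simp_all add: rep_zero rep_add)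

lemma rep_prod_list: "rep (prod_list (map f xs)) w = foldr (\<lambda>i. rep (f i)) xs w"
  by (induction xs) (simp_all add: rep_one rep_mult)

lemma rep_hscalar: "rep (hscalar c) = scale c"
  by (simp add: rep_def act_scalar)

lemma rep_hgen_commutator:
  assumes "k \<noteq> 0" "l \<noteq> 0"
  shows "rep (hgen k) (rep (hgen l) w) =
    rep (hgen l) (rep (hgen k) w) + scale (if k = - l then of_int k * a k else 0) w"
proof -
  have "rep (hgen k * hgen l - hgen l * hgen k - hscalar (if k = - l then of_int k * a k else 0)) w = 0"
    using heis_class_relation[OF assms, of a] rep_zero by (simp add: rep_def)
  then show ?thesis
    by (simp only: rep_diff rep_mult rep_hscalar) (simp add: algebra_simps)
qed

sublocale heisenberg_operators scale "\<lambda>k. rep (hgen k)" a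
  by (intro heisenberg_operators.intro heisenberg_operators_axioms.intro vector_space_axioms
      rep_linear rep_hgen_commutator)

lemma act_heis_D: "act (heis_D a n) = D n"
  by (rule ext) (simp add: heis_D_def rep_def[symmetric] rep_sum rep_mult rep_prod_list rep_hscalar
      D.partition_sum_def)

lemma act_heis_U: "act (heis_U a n) = U n"
  by (rule ext) (simp add: heis_U_def rep_def[symmetric] rep_sum rep_mult rep_prod_list rep_hscalar
      U.partition_sum_def)

section \<open>Coordinates, grading and highest weight vectors\<close>

lemma basis_expansion:
  obtains A c where "finite A" "w = (\<Sum>s\<in>A. scale (c s) (v s))"
proof -
  have "w \<in> span (range v)" by (simp add: basis_span)
  then obtain T r where T: "finite T" "T \<subseteq> range v" "w = (\<Sum>u\<in>T. scale (r u) u)"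
    unfolding span_explicit by auto
  have "w = (\<Sum>s\<in>v -` T. scale (r (v s)) (v s))"
    using T by (subst sum.reindex[OF inj_on_subset[OF basis_inj], symmetric, simplified comp_def])
      (auto simp: image_vimage_eq Int_absorb2 comp_def sum.reindex)
  moreover have "finite (v -` T)" using T(1) basis_inj by (rule finite_vimageI)
  ultimately show ?thesis using that[of "v -` T" "\<lambda>s. r (v s)"] by blast
qed

lemma ip_sum_basis:
  assumes "finite A"
  shows "ip (\<Sum>s\<in>A. scale (c s) (v s)) (v s') = (if s' \<in> A then c s' else 0)"
proof -
  have "ip (\<Sum>s\<in>A. scale (c s) (v s)) (v s') = (\<Sum>s\<in>A. if s = s' then c s else 0)"
    by (simp add: linear_sum_apply[OF ip_linear_left] linear_scale_apply[OF ip_linear_left] ip_basis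
        if_distrib[of "(*) _"] cong: if_cong)
  also have "\<dots> = (if s' \<in> A then c s' else 0)"
    using assms by (simp add: sum.delta)
  finally show ?thesis .
qed

text \<open>The coordinates of \<open>w\<close> are its inner products with the basis; this turns a
  matrix coefficient of a composition into a sum over the basis. Any finite \<open>A\<close>
  covering the support is allowed, so that it can be chosen by degree.\<close>

lemma functional_expansion:
  assumes L: "Vector_Spaces.linear scale (*) L"
    and A: "finite A" "\<And>s. ip w (v s) \<noteq> 0 \<Longrightarrow> s \<in> A"
  shows "L w = (\<Sum>s\<in>A. ip w (v s) * L (v s))"
proof -
  obtain C c where C: "finite C" and w: "w = (\<Sum>s\<in>C. scale (c s) (v s))"
    by (rule basis_expansion)
  have ip: "ip w (v s) = (if s \<in> C then c s else 0)" for s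
    unfolding w by (rule ip_sum_basis[OF C])
  have "L w = (\<Sum>s\<in>C. ip w (v s) * L (v s))"
    by (subst w) (simp add: linear_sum_apply[OF L] linear_scale_apply[OF L] ip)
  also have "\<dots> = (\<Sum>s\<in>A. ip w (v s) * L (v s))"
  proof -
    have "ip w (v s) = 0" if "s \<notin> A" for s
      using that A(2) by blast
    moreover have "ip w (v s) = 0" if "s \<notin> C" for s
      using that by (simp add: ip)
    ultimately show ?thesis
      by (intro sum.mono_neutral_cong[OF A(1) C]) simp_all
  qed
  finally show ?thesis .
qed

text \<open>Two decompositions of \<open>w\<close> into homogeneous components are compared:
  \<open>e\<close> puts \<open>w\<close> in degree \<open>n\<close>, and \<open>e'\<close> groups
  its basis expansion by degree. By uniqueness only basis vectors of degree \<open>n\<close>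
  occur.\<close>

lemma ip_nonzero_imp_sdeg:
  assumes "w \<in> gr n" "ip w (v s) \<noteq> 0"
  shows "sdeg s = n"
proof (rule ccontr)
  assume "sdeg s \<noteq> n"
  obtain C c where C: "finite C" and w: "w = (\<Sum>s\<in>C. scale (c s) (v s))"
    by (rule basis_expansion)
  define e where "e k = (if k = n then w else 0)" for k
  define e' where "e' k = (\<Sum>s\<in>{s\<in>C. sdeg s = k}. scale (c s) (v s))" for k
  let ?P = "\<lambda>e. finite {n. e n \<noteq> 0} \<and> (\<forall>n. e n \<in> gr n) \<and> w = (\<Sum>n | e n \<noteq> 0. e n)"
  have "?P e"
  proof (intro conjI allI)
    show "finite {k. e k \<noteq> 0}" by (rule finite_subset[of _ "{n}"]) (auto simp: e_def)
    show "e k \<in> gr k" for k using assms(1) subspace_0[OF gr_subspace] by (simp add: e_def)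
    show "w = (\<Sum>k | e k \<noteq> 0. e k)"
    proof (cases "w = 0")
      case False
      then have "{k. e k \<noteq> 0} = {n}" by (auto simp: e_def)
      then show ?thesis by (simp add: e_def)
    qed (simp add: e_def)
  qed
  moreover have "?P e'"
  proof (intro conjI allI)
    have sub: "{k. e' k \<noteq> 0} \<subseteq> sdeg ` C"
      by (auto simp: e'_def elim!: sum.not_neutral_contains_not_neutral)
    then show "finite {k. e' k \<noteq> 0}" using C by (rule finite_subset[OF _ finite_imageI])
    show "e' k \<in> gr k" for k
      unfolding e'_def by (intro subspace_sum gr_subspace subspace_scale) (auto intro: basis_homogeneous)
    have "(\<Sum>k | e' k \<noteq> 0. e' k) = (\<Sum>k\<in>sdeg ` C. e' k)"
      using C sub by (intro sum.mono_neutral_left) auto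
    also have "\<dots> = w"
      unfolding w e'_def by (rule sum.image_gen[OF C, symmetric])
    finally show "w = (\<Sum>k | e' k \<noteq> 0. e' k)" ..
  qed
  ultimately have "e = e'" using gr_direct_sum[of w] by blast
  then have "w = e' n" by (auto simp: e_def dest: fun_cong[of _ _ n])
  then have "ip w (v s) = 0"
    using ip_sum_basis[of "{s\<in>C. sdeg s = n}" c s] C \<open>sdeg s \<noteq> n\<close> by (simp add: e'_def)
  with assms(2) show False by simp
qed

text \<open>The basis vectors of degree \<open>n\<close> are independent inside a finite-dimensional
  component. This keeps each bihomogeneous part of the sums over the basis finite.\<close>

lemma finite_sdeg: "finite {s. sdeg s = n}"
proof -
  obtain A where A: "finite A" "span A = gr n" using gr_finite_dim by blast
  have "independent (v ` {s. sdeg s = n})"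
    using basis_independent by (rule independent_mono) auto
  then have "finite (v ` {s. sdeg s = n})"
    using independent_span_bound[OF A(1)] A(2) basis_homogeneous by fastforce
  then show ?thesis by (rule finite_imageD) (rule inj_on_subset[OF basis_inj], simp)
qed

text \<open>The sign of the degree shift is left open: \<open>q\<close> is \<open>m\<close> for
  \<open>U\<close> and \<open>- m\<close> for \<open>D\<close>.\<close>

lemma partition_sum_graded:
  assumes "commuting_operators scale P"
    and P: "\<And>i d w. i > 0 \<Longrightarrow> w \<in> gr d \<Longrightarrow> P i w \<in> gr (d + q * int i)"
    and "w \<in> gr d"
  shows "commuting_operators.partition_sum scale P n w \<in> gr (d + q * int n)"
proof -
  interpret P: commuting_operators scale P by fact
  have "foldr P \<mu> w \<in> gr (d + q * int (sum_list \<mu>))" if "0 \<notin> set \<mu>" for \<mu>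
    using that
  proof (induction \<mu>)
    case (Cons i \<mu>)
    then have "P i (foldr P \<mu> w) \<in> gr (d + q * int (sum_list \<mu>) + q * int i)"
      by (intro P) auto
    then show ?case by (simp add: algebra_simps)
  qed (simp add: assms(3))
  then show ?thesis
    unfolding P.partition_sum_def
    by (intro subspace_sum gr_subspace subspace_scale) (auto simp: partitions_def)
qed

lemma U_graded: "w \<in> gr d \<Longrightarrow> U n w \<in> gr (d + m * int n)"
proof (rule partition_sum_graded[OF U.commuting_operators_axioms])
  show "rep (hgen (- int i)) u \<in> gr (d + m * int i)" if "i > 0" "u \<in> gr d" for i d u
    using act_graded[of "- int i" u d] that by (simp add: rep_def)
qed

lemma D_graded: "w \<in> gr d \<Longrightarrow> D n w \<in> gr (d + - m * int n)"
proof (rule partition_sum_graded[OF D.commuting_operators_axioms])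
  show "rep (hgen (int i)) u \<in> gr (d + - m * int i)" if "i > 0" "u \<in> gr d" for i d u
    using act_graded[of "int i" u d] that by (simp add: rep_def)
qed

text \<open>In Newton's recursion the term \<open>i = n\<close> is \<open>B_n w = 0\<close>, and in
  the others \<open>D_{n-i} w = 0\<close> by induction.\<close>

lemma D_highest_weight:
  assumes "highest_weight_vector a act w" "n > 0"
  shows "D n w = 0"
  using assms(2)
proof (induction n rule: less_induct)
  case (less n)
  have "rep (hgen (int i)) (D (n - i) w) = 0" if "i \<in> {1..n}" for i
  proof (cases "i = n")
    case True
    then show ?thesis using assms(1) less.prems
      by (simp add: highest_weight_vector_def rep_def[symmetric])
  next
    case False
    then show ?thesis using that by (simp add: less.IH linear_zero_apply[OF rep_linear])
  qed
  then have "scale (of_nat n) (D n w) = 0" by (simp add: D.partition_sum_newton)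
  then show ?case using less.prems by simp
qed

section \<open>Iterated raising and lowering operators\<close>

abbreviation U_seq :: "(nat \<Rightarrow>\<^sub>0 nat) \<Rightarrow> 'v \<Rightarrow> 'v" where "U_seq \<equiv> act_seq act (heis_U a)"
abbreviation D_seq :: "(nat \<Rightarrow>\<^sub>0 nat) \<Rightarrow> 'v \<Rightarrow> 'v" where "D_seq \<equiv> act_seq act (heis_D a)"

lemma U_seq_eq_fold:
  "distinct xs \<Longrightarrow> Poly_Mapping.keys \<alpha> \<subseteq> set xs \<Longrightarrow>
    U_seq \<alpha> w = fold (\<lambda>i. U (Poly_Mapping.lookup \<alpha> i)) xs w"
  by (subst act_seq_eq_fold[of xs]) (simp_all add: act_heis_U U.partition_sum_commute)

lemma D_seq_eq_fold:
  "distinct xs \<Longrightarrow> Poly_Mapping.keys \<alpha> \<subseteq> set xs \<Longrightarrow>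
    D_seq \<alpha> w = fold (\<lambda>i. D (Poly_Mapping.lookup \<alpha> i)) xs w"
  by (subst act_seq_eq_fold[of xs]) (simp_all add: act_heis_D D.partition_sum_commute)

lemma U_seq_map_key: "bij \<pi> \<Longrightarrow> U_seq (Poly_Mapping.map_key \<pi> \<alpha>) = U_seq \<alpha>"
  by (rule act_seq_map_key) (simp_all add: act_heis_U U.partition_sum_commute)

lemma D_seq_map_key: "bij \<pi> \<Longrightarrow> D_seq (Poly_Mapping.map_key \<pi> \<alpha>) = D_seq \<alpha>"
  by (rule act_seq_map_key) (simp_all add: act_heis_D D.partition_sum_commute)

lemma linear_U_seq: "Vector_Spaces.linear scale scale (U_seq \<alpha>)"
  unfolding act_seq_def[abs_def] act_heis_U
  by (rule linear_fold[OF vector_space_axioms U.linear_partition_sum, unfolded eta_contract_eq])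

lemma linear_D_seq: "Vector_Spaces.linear scale scale (D_seq \<alpha>)"
  unfolding act_seq_def[abs_def] act_heis_D
  by (rule linear_fold[OF vector_space_axioms D.linear_partition_sum, unfolded eta_contract_eq])

lemma act_seq_graded:
  assumes "\<And>n d w. w \<in> gr d \<Longrightarrow> act (E n) w \<in> gr (d + q * int n)" "w \<in> gr d"
  shows "act_seq act E \<alpha> w \<in> gr (d + q * int (mdeg \<alpha>))"
proof -
  have "fold (\<lambda>i. act (E (Poly_Mapping.lookup \<alpha> i))) xs w \<in>
      gr (d + q * int (\<Sum>i\<leftarrow>xs. Poly_Mapping.lookup \<alpha> i))" if "w \<in> gr d" for xs d w
    using that
  proof (induction xs arbitrary: w d)
    case (Cons i xs)
    from Cons.IH[OF assms(1)[OF Cons.prems]] show ?case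
      by (simp add: algebra_simps)
  qed simp
  moreover have "mdeg \<alpha> = (\<Sum>i\<leftarrow>[0..<Poly_Mapping.degree \<alpha>]. Poly_Mapping.lookup \<alpha> i)"
    by (subst mdeg_eq_sum[of "{0..<Poly_Mapping.degree \<alpha>}"])
       (auto simp: sum_list_distinct_conv_sum_set dest: Poly_Mapping.in_keys_less_degree)
  ultimately show ?thesis unfolding act_seq_def using assms(2) by simp
qed

lemma U_seq_graded: "w \<in> gr d \<Longrightarrow> U_seq \<alpha> w \<in> gr (d + m * int (mdeg \<alpha>))"
  by (rule act_seq_graded) (simp_all add: act_heis_U U_graded)

lemma D_seq_graded: "w \<in> gr d \<Longrightarrow> D_seq \<alpha> w \<in> gr (d - m * int (mdeg \<alpha>))"
  using act_seq_graded[of "heis_D a" "- m" w d \<alpha>] by (simp add: act_heis_D D_graded[simplified])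

text \<open>The order of the variables is free, so one with non-zero exponent can act first, and it
  already kills \<open>w\<close>.\<close>

lemma D_seq_highest_weight:
  assumes "highest_weight_vector a act w"
  shows "D_seq \<beta> w = (if \<beta> = 0 then w else 0)"
proof (cases "\<beta> = 0")
  case True
  then show ?thesis by (simp add: act_seq_def)
next
  case False
  then obtain i where i: "i \<in> Poly_Mapping.keys \<beta>" by (metis equals0I keys_eq_empty)
  obtain xs where xs: "set xs = Poly_Mapping.keys \<beta> - {i}" "distinct xs"
    using finite_distinct_list[of "Poly_Mapping.keys \<beta> - {i}"] by auto
  have "D_seq \<beta> w = fold (\<lambda>i. D (Poly_Mapping.lookup \<beta> i)) (i # xs) w"
    by (rule D_seq_eq_fold) (use xs i in auto)
  also have "\<dots> = fold (\<lambda>i. D (Poly_Mapping.lookup \<beta> i)) xs 0"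
    using i D_highest_weight[OF assms] by (simp add: in_keys_iff)
  also have "\<dots> = 0"
    by (rule linear_zero_apply[OF linear_fold[OF vector_space_axioms D.linear_partition_sum]])
  finally show ?thesis using False by simp
qed

end

section \<open>Reordering words of operators\<close>

locale heisenberg_cauchy =
  graded_heisenberg_rep scale a act v sdeg gr m ip + power_sum_specialization a \<kappa>
  for scale :: "'k::field_char_0 \<Rightarrow> 'v::ab_group_add \<Rightarrow> 'v"
    and a :: "int \<Rightarrow> 'k" and act and v :: "'s \<Rightarrow> 'v" and sdeg gr m ip
    and \<kappa> :: "(nat, 'k) mfps \<Rightarrow> 'k"
begin

abbreviation hspec :: "nat \<Rightarrow> 'k" where
  "hspec n \<equiv> \<kappa> (complete_sym n)"

definition letter_op :: "(nat + nat \<Rightarrow>\<^sub>0 nat) \<Rightarrow> nat + nat \<Rightarrow> 'v \<Rightarrow> 'v" where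
  "letter_op \<mu> x = (case x of Inl _ \<Rightarrow> U (Poly_Mapping.lookup \<mu> x) | Inr _ \<Rightarrow> D (Poly_Mapping.lookup \<mu> x))"

lemma linear_letter_op: "Vector_Spaces.linear scale scale (letter_op \<mu> x)"
  by (cases x) (simp_all add: letter_op_def U.linear_partition_sum D.linear_partition_sum)

text \<open>
  A word of letters \<open>x\<^sub>j\<close> (\<open>Inl j\<close>) and \<open>y\<^sub>k\<close> (\<open>Inr k\<close>) stands for the product, first letter
  applied first, of the generating series of \<open>U\<close> in \<open>x\<^sub>j\<close> and of \<open>D\<close> in \<open>y\<^sub>k\<close>;
  \<open>word_series\<close> is its matrix coefficient.
\<close>

definition word_series :: "'s \<Rightarrow> 's \<Rightarrow> (nat + nat) list \<Rightarrow> (nat + nat, 'k) mfps" where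
  "word_series t r xs = Abs_mfps (\<lambda>\<mu>.
     if Poly_Mapping.keys \<mu> \<subseteq> set xs then ip (fold (letter_op \<mu>) xs (v t)) (v r) else 0)"

text \<open>By \<open>D_U\<close>, exchanging the two adjacent letters yields terms
  \<open>hspec n\<close> in which the exponents of \<open>x_j\<close> and \<open>y_k\<close> are
  both lowered by \<open>n\<close>. This is multiplication by \<open>diag_series\<close>.
  Distinctness ensures that the lowering affects no other letter.\<close>

lemma word_series_swap:
  assumes "distinct (xs @ [Inl j, Inr k] @ ys)"
  shows "word_series t r (xs @ [Inl j, Inr k] @ ys) =
    diag_series hspec j k * word_series t r (xs @ [Inr k, Inl j] @ ys)"
proof (rule mfps_eqI)
  fix \<mu> :: "nat + nat \<Rightarrow>\<^sub>0 nat"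
  let ?l = "Poly_Mapping.lookup \<mu>"
  let ?e = "\<lambda>n. Poly_Mapping.single (Inl j :: nat + nat) n + Poly_Mapping.single (Inr k) n"
  let ?N = "min (?l (Inl j)) (?l (Inr k))"
  let ?S = "set (xs @ [Inl j, Inr k] @ ys)"
  have lookup_e: "Poly_Mapping.lookup (\<mu> - ?e n) x =
      ?l x - (if x = Inl j \<or> x = Inr k then n else 0)" for n x
    by (auto simp: lookup_minus lookup_add lookup_single when_def)
  \<comment> \<open>Only exponents of letters of the word are lowered, so the support condition in
    \<open>word_series\<close> is the same for \<open>\<mu>\<close> and
    \<open>\<mu> - ?e n\<close>.\<close>
  have "x \<in> ?S \<or> (x \<in> Poly_Mapping.keys (\<mu> - ?e n) \<longleftrightarrow> x \<in> Poly_Mapping.keys \<mu>)" for n x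
    by (auto simp: in_keys_iff lookup_e)
  then have keys: "Poly_Mapping.keys (\<mu> - ?e n) \<subseteq> ?S \<longleftrightarrow> Poly_Mapping.keys \<mu> \<subseteq> ?S" for n
    by blast
  have S: "set (xs @ [Inr k, Inl j] @ ys) = ?S" by auto
  show "mcoeff (word_series t r (xs @ [Inl j, Inr k] @ ys)) \<mu> =
      mcoeff (diag_series hspec j k * word_series t r (xs @ [Inr k, Inl j] @ ys)) \<mu>"
  proof (cases "Poly_Mapping.keys \<mu> \<subseteq> ?S")
    case True
    define u where "u = fold (letter_op \<mu>) xs (v t)"
    \<comment> \<open>\<open>u\<close> absorbs the letters before the exchanged pair;
      \<open>L\<close> absorbs those after it together with the pairing, as a linear
      functional.\<close>
    define L where "L w = ip (fold (letter_op \<mu>) ys w) (v r)" for w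
    have L: "Vector_Spaces.linear scale (*) L"
      unfolding L_def[abs_def]
      by (rule linear_comp_apply[OF linear_fold[OF vector_space_axioms linear_letter_op] ip_linear_left])
    have same: "fold (letter_op (\<mu> - ?e n)) zs = fold (letter_op \<mu>) zs" if "set zs \<subseteq> ?S - {Inl j, Inr k}" for zs n
      by (rule ext, rule fold_cong) (use that in \<open>auto simp: letter_op_def lookup_e split: sum.split\<close>)
    have same_xs: "fold (letter_op (\<mu> - ?e n)) xs = fold (letter_op \<mu>) xs"
      and same_ys: "fold (letter_op (\<mu> - ?e n)) ys = fold (letter_op \<mu>) ys" for n
      using assms by (auto intro!: same)
    have "mcoeff (word_series t r (xs @ [Inl j, Inr k] @ ys)) \<mu> = L (D (?l (Inr k)) (U (?l (Inl j)) u))"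
      using True by (simp add: word_series_def u_def L_def letter_op_def)
    also have "\<dots> = (\<Sum>n\<le>?N. hspec n * L (U (?l (Inl j) - n) (D (?l (Inr k) - n) u)))"
      by (simp add: D_U[of hspec, OF kappa_complete_sym_0 kappa_newton]
          linear_sum_apply[OF L] linear_scale_apply[OF L])
    also have "\<dots> = (\<Sum>n\<le>?N. hspec n *
        mcoeff (word_series t r (xs @ [Inr k, Inl j] @ ys)) (\<mu> - ?e n))"
    proof (rule sum.cong[OF refl])
      fix n
      have "mcoeff (word_series t r (xs @ [Inr k, Inl j] @ ys)) (\<mu> - ?e n) =
          ip (fold (letter_op (\<mu> - ?e n)) (xs @ [Inr k, Inl j] @ ys) (v t)) (v r)"
        unfolding word_series_def S using True keys by simp
      also have "\<dots> = L (U (?l (Inl j) - n) (D (?l (Inr k) - n) u))"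
        by (simp add: same_xs same_ys u_def L_def) (simp add: letter_op_def lookup_e)
      finally show "hspec n * L (U (?l (Inl j) - n) (D (?l (Inr k) - n) u)) =
          hspec n * mcoeff (word_series t r (xs @ [Inr k, Inl j] @ ys)) (\<mu> - ?e n)"
        by simp
    qed
    also have "\<dots> = mcoeff (diag_series hspec j k * word_series t r (xs @ [Inr k, Inl j] @ ys)) \<mu>"
      by (rule mcoeff_diag_series_times[of hspec, OF kappa_complete_sym_0, symmetric])
    finally show ?thesis .
  next
    \<comment> \<open>A variable outside the word makes every coefficient on both sides
      vanish.\<close>
    case False
    then show ?thesis
      unfolding mcoeff_diag_series_times[of hspec, OF kappa_complete_sym_0]
      unfolding word_series_def S using keys by simp
  qed
qed

text \<open>\<open>x_j\<close> passes the letters \<open>y_k\<close> one at a time; the prefix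
  \<open>xs\<close> is generalized to collect those already passed.\<close>

lemma word_series_move:
  assumes "distinct (xs @ Inl j # map Inr ks @ ys)"
  shows "word_series t r (xs @ Inl j # map Inr ks @ ys) =
    (\<Prod>k\<in>set ks. diag_series hspec j k) * word_series t r (xs @ map Inr ks @ Inl j # ys)"
  using assms
proof (induction ks arbitrary: xs)
  case (Cons k ks)
  have "word_series t r (xs @ Inl j # map Inr (k # ks) @ ys) =
      diag_series hspec j k * word_series t r ((xs @ [Inr k]) @ Inl j # map Inr ks @ ys)"
    using word_series_swap[of xs j k "map Inr ks @ ys"] Cons.prems by simp
  also have "\<dots> = (\<Prod>k\<in>set (k # ks). diag_series hspec j k) *
      word_series t r (xs @ map Inr (k # ks) @ Inl j # ys)"
  proof -
    have "k \<notin> set ks" using Cons.prems by auto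
    then show ?thesis using Cons.prems by (subst Cons.IH) (simp_all add: mult.assoc)
  qed
  finally show ?case .
qed simp

text \<open>The last X-letter is adjacent to the Y-block, so it is moved first, hence the reverse
  induction. The tail \<open>ys\<close> collects the X-letters already moved.\<close>

lemma word_series_reorder:
  assumes "distinct (map Inl js @ map Inr ks @ ys)"
  shows "word_series t r (map Inl js @ map Inr ks @ ys) =
    (\<Prod>(j, k)\<in>set js \<times> set ks. diag_series hspec j k) * word_series t r (map Inr ks @ map Inl js @ ys)"
  using assms
proof (induction js arbitrary: ys rule: rev_induct)
  case (snoc j js)
  have "word_series t r (map Inl (js @ [j]) @ map Inr ks @ ys) =
      (\<Prod>k\<in>set ks. diag_series hspec j k) * word_series t r (map Inl js @ map Inr ks @ Inl j # ys)"
    using word_series_move[of "map Inl js" j ks ys] snoc.prems by simp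
  also have "\<dots> = (\<Prod>k\<in>set ks. diag_series hspec j k) *
      (\<Prod>(j, k)\<in>set js \<times> set ks. diag_series hspec j k) *
      word_series t r (map Inr ks @ map Inl (js @ [j]) @ ys)"
    using snoc.prems by (subst snoc.IH) (auto simp: mult.assoc)
  also have "(\<Prod>k\<in>set ks. diag_series hspec j k) * (\<Prod>(j, k)\<in>set js \<times> set ks. diag_series hspec j k) =
      (\<Prod>(j, k)\<in>set (js @ [j]) \<times> set ks. diag_series hspec j k)"
  proof -
    have "j \<notin> set js" using snoc.prems by auto
    then show ?thesis unfolding prod.cartesian_product[symmetric] by simp
  qed
  finally show ?case .
qed simp

section \<open>The two orderings in all variables\<close>

definition DU_series :: "'s \<Rightarrow> 's \<Rightarrow> (nat + nat, 'k) mfps" where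
  "DU_series t r = Abs_mfps (\<lambda>\<mu>.
     ip (D_seq (Poly_Mapping.map_key Inr \<mu>) (U_seq (Poly_Mapping.map_key Inl \<mu>) (v t))) (v r))"

definition UD_series :: "'s \<Rightarrow> 's \<Rightarrow> (nat + nat, 'k) mfps" where
  "UD_series t r = Abs_mfps (\<lambda>\<mu>.
     ip (U_seq (Poly_Mapping.map_key Inl \<mu>) (D_seq (Poly_Mapping.map_key Inr \<mu>) (v t))) (v r))"

text \<open>Variables with exponent 0 act as the identity, so a bound on the variables of
  \<open>\<mu>\<close> reduces each series to a finite word. The names follow operator notation, the
  right factor acting first, whereas words list the letter acting first on the left.\<close>

lemma
  assumes "Poly_Mapping.keys \<mu> \<subseteq> Inl ` {..<N} \<union> Inr ` {..<N}"
  shows mcoeff_DU_series: "mcoeff (DU_series t r) \<mu> =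
      mcoeff (word_series t r (map Inl [0..<N] @ map Inr [0..<N])) \<mu>"
    and mcoeff_UD_series: "mcoeff (UD_series t r) \<mu> =
      mcoeff (word_series t r (map Inr [0..<N] @ map Inl [0..<N])) \<mu>"
proof -
  have "Poly_Mapping.keys (Poly_Mapping.map_key Inl \<mu>) \<subseteq> set [0..<N]"
    "Poly_Mapping.keys (Poly_Mapping.map_key Inr \<mu>) \<subseteq> set [0..<N]"
    using assms by (auto simp: keys_map_key)
  then have
    "U_seq (Poly_Mapping.map_key Inl \<mu>) w = fold (letter_op \<mu>) (map Inl [0..<N]) w"
    "D_seq (Poly_Mapping.map_key Inr \<mu>) w = fold (letter_op \<mu>) (map Inr [0..<N]) w" for w
    by (simp_all add: U_seq_eq_fold[of "[0..<N]"] D_seq_eq_fold[of "[0..<N]"] fold_map comp_def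
        letter_op_def lookup_map_key)
  moreover have "Poly_Mapping.keys \<mu> \<subseteq> set (map Inl [0..<N] @ map Inr [0..<N])"
    "Poly_Mapping.keys \<mu> \<subseteq> set (map Inr [0..<N] @ map Inl [0..<N])"
    using assms by (auto simp: atLeast0LessThan)
  ultimately show
    "mcoeff (DU_series t r) \<mu> = mcoeff (word_series t r (map Inl [0..<N] @ map Inr [0..<N])) \<mu>"
    "mcoeff (UD_series t r) \<mu> = mcoeff (word_series t r (map Inr [0..<N] @ map Inl [0..<N])) \<mu>"
    unfolding DU_series_def UD_series_def word_series_def by simp_all
qed

text \<open>Compared at one coefficient, both sides involve only the first \<open>N\<close>
  variables of each alphabet, where \<open>word_series_reorder\<close> applies.\<close>

lemma DU_series_eq: "DU_series t r = diag_prod hspec * UD_series t r"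
proof (rule mfps_eqI)
  fix \<mu> :: "nat + nat \<Rightarrow>\<^sub>0 nat"
  obtain N where bound: "\<forall>x\<in>Poly_Mapping.keys \<mu>. case_sum id id x < N"
    using finite_nat_set_iff_bounded[of "case_sum id id ` Poly_Mapping.keys \<mu>"] by auto
  have N: "Poly_Mapping.keys \<mu> \<subseteq> Inl ` {..<N} \<union> Inr ` {..<N}"
  proof
    fix x assume "x \<in> Poly_Mapping.keys \<mu>"
    then show "x \<in> Inl ` {..<N} \<union> Inr ` {..<N}"
      using bspec[OF bound, of x] by (cases x) auto
  qed
  let ?J = "{..<N} \<times> {..<N}"
  have "mcoeff (diag_prod hspec * UD_series t r) \<mu> =
      mcoeff ((\<Prod>(j, k)\<in>?J. diag_series hspec j k) *
        word_series t r (map Inr [0..<N] @ map Inl [0..<N])) \<mu>"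
    unfolding times_mfps.rep_eq
  proof (intro sum.cong refl, clarify)
    fix p q assume "(p, q) \<in> splittings \<mu>"
    then have \<mu>: "\<mu> = p + q" by (simp add: mem_splittings)
    \<comment> \<open>The factors of a splitting of \<open>\<mu>\<close> contain no new variables,
      so the same \<open>N\<close> serves for \<open>p\<close> and \<open>q\<close>.\<close>
    have "Poly_Mapping.keys p \<subseteq> Poly_Mapping.keys \<mu>" "Poly_Mapping.keys q \<subseteq> Poly_Mapping.keys \<mu>"
      by (auto simp: \<mu> in_keys_iff lookup_add)
    with N have p: "Poly_Mapping.keys p \<subseteq> Inl ` {..<N} \<union> Inr ` {..<N}"
      and q: "Poly_Mapping.keys q \<subseteq> Inl ` {..<N} \<union> Inr ` {..<N}" by auto
    have "active_pairs p \<subseteq> ?J"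
      using p by (auto simp: active_pairs_def in_keys_iff subset_iff)
    then have "mcoeff (diag_prod hspec) p = mcoeff (\<Prod>(j, k)\<in>?J. diag_series hspec j k) p"
      by (intro mcoeff_diag_prod[symmetric]) (simp_all add: kappa_complete_sym_0)
    then show "mcoeff (diag_prod hspec) p * mcoeff (UD_series t r) q =
        mcoeff (\<Prod>(j, k)\<in>?J. diag_series hspec j k) p *
        mcoeff (word_series t r (map Inr [0..<N] @ map Inl [0..<N])) q"
      by (simp add: mcoeff_UD_series[OF q])
  qed
  also have "\<dots> = mcoeff (word_series t r (map Inl [0..<N] @ map Inr [0..<N])) \<mu>"
  proof -
    have "distinct (map Inl [0..<N] @ map Inr [0..<N] @ [])"
      by (auto simp: distinct_map)
    from word_series_reorder[OF this, of t r] show ?thesis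
      by (simp add: atLeast0LessThan)
  qed
  also have "\<dots> = mcoeff (DU_series t r) \<mu>"
    by (rule mcoeff_DU_series[OF N, symmetric])
  finally show "mcoeff (DU_series t r) \<mu> = mcoeff (diag_prod hspec * UD_series t r) \<mu>" ..
qed

text \<open>Any non-trivial \<open>D_seq\<close> kills the vector, and any non-trivial
  \<open>U_seq\<close> changes its degree because \<open>m \<noteq> 0\<close>, which makes the inner
  product with \<open>v b\<close> zero.\<close>

lemma UD_series_highest_weight:
  assumes "highest_weight_vector a act (v b)"
  shows "UD_series b b = 1"
proof (rule mfps_eqI)
  fix \<mu> :: "nat + nat \<Rightarrow>\<^sub>0 nat"
  let ?X = "Poly_Mapping.map_key Inl \<mu>" and ?Y = "Poly_Mapping.map_key Inr \<mu>"
  have "mcoeff (UD_series b b) \<mu> = (if ?Y = 0 then ip (U_seq ?X (v b)) (v b) else 0)"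
    by (simp add: UD_series_def D_seq_highest_weight[OF assms] linear_zero_apply[OF linear_U_seq]
        linear_zero_apply[OF ip_linear_left])
  also have "ip (U_seq ?X (v b)) (v b) = (if ?X = 0 then 1 else 0)"
  proof (cases "?X = 0")
    case True
    then show ?thesis by (simp add: act_seq_def ip_basis)
  next
    case False
    then have "sdeg b \<noteq> sdeg b + m * int (mdeg ?X)"
      using m_nonzero by (simp add: mdeg_eq_0_iff)
    then have "ip (U_seq ?X (v b)) (v b) = 0"
      using ip_nonzero_imp_sdeg[OF U_seq_graded[OF basis_homogeneous]] by blast
    then show ?thesis using False by simp
  qed
  also have "(if ?Y = 0 then if ?X = 0 then 1 else 0 else 0) = (mcoeff 1 \<mu> :: 'k)"
  proof -
    have "\<mu> = 0" if "?X = 0" "?Y = 0"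
    proof (rule poly_mapping_eqI)
      fix x
      have "Poly_Mapping.lookup ?X i = 0" "Poly_Mapping.lookup ?Y i = 0" for i
        using that by simp_all
      then show "Poly_Mapping.lookup \<mu> x = Poly_Mapping.lookup 0 x"
        by (cases x) (simp_all add: lookup_map_key)
    qed
    then show ?thesis by (auto simp: one_mfps.rep_eq)
  qed
  finally show "mcoeff (UD_series b b) \<mu> = mcoeff 1 \<mu>" .
qed

section \<open>The two sums over the basis\<close>

lemma sym_fun_XY_skew:
  "in_X (skew_F a act v ip p q) * in_Y (skew_G a act v ip s t) \<in> sym_fun_XY"
  by (auto simp: sym_fun_XY_def mcoeff_in_X_times_in_Y map_key_map_sum skew_F_def skew_G_def
      U_seq_map_key D_seq_map_key)

text \<open>The basis is inserted between the \<open>U\<close>'s and the \<open>D\<close>'s. The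
  intermediate vector has degree \<open>sdeg t - m * j\<close>, so only the Y-degree
  \<open>j\<close> decides which indices contribute.\<close>

lemma has_completed_sum_UD:
  "has_completed_sum (\<lambda>s. in_X (skew_F a act v ip r s) * in_Y (skew_G a act v ip t s)) (UD_series t r)"
proof (rule has_completed_sumI[where A = "\<lambda>i j. {s. sdeg s = sdeg t - m * int j}"])
  show "in_X (skew_F a act v ip r s) * in_Y (skew_G a act v ip t s) \<in> sym_fun_XY" for s
    by (rule sym_fun_XY_skew)
  show "finite {s. sdeg s = sdeg t - m * int j}" for j
    by (rule finite_sdeg)
  show "UD_series t r \<in> sym_fun_XY"
    by (auto simp: sym_fun_XY_def UD_series_def map_key_map_sum U_seq_map_key D_seq_map_key)
  have deg: "sdeg s = sdeg t - m * int (mdeg \<beta>)" if "ip (D_seq \<beta> (v t)) (v s) \<noteq> 0" for s \<beta>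
    using ip_nonzero_imp_sdeg[OF D_seq_graded[OF basis_homogeneous] that] .
  then show "s \<in> {s. sdeg s = sdeg t - m * int (mdeg (Poly_Mapping.map_key Inr \<mu>))}"
    if "mcoeff (in_X (skew_F a act v ip r s) * in_Y (skew_G a act v ip t s)) \<mu> \<noteq> 0" for s \<mu>
    using that by (simp add: mcoeff_in_X_times_in_Y skew_F_def skew_G_def)
  show "mcoeff (UD_series t r) \<mu> =
      (\<Sum>s | sdeg s = sdeg t - m * int (mdeg (Poly_Mapping.map_key Inr \<mu>)).
        mcoeff (in_X (skew_F a act v ip r s) * in_Y (skew_G a act v ip t s)) \<mu>)" for \<mu>
    using functional_expansion[OF linear_comp_apply[OF linear_U_seq ip_linear_left[of "v r"]] finite_sdeg,
        of "D_seq (Poly_Mapping.map_key Inr \<mu>) (v t)"] deg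
    by (simp add: UD_series_def mcoeff_in_X_times_in_Y skew_F_def skew_G_def mult.commute)
qed

text \<open>Here the \<open>U\<close>'s act first, so the intermediate degree, and with it the
  finite index set, depends on the X-degree.\<close>

lemma has_completed_sum_DU:
  "has_completed_sum (\<lambda>s. in_X (skew_F a act v ip s t) * in_Y (skew_G a act v ip s r)) (DU_series t r)"
proof (rule has_completed_sumI[where A = "\<lambda>i j. {s. sdeg s = sdeg t + m * int i}"])
  show "in_X (skew_F a act v ip s t) * in_Y (skew_G a act v ip s r) \<in> sym_fun_XY" for s
    by (rule sym_fun_XY_skew)
  show "finite {s. sdeg s = sdeg t + m * int i}" for i
    by (rule finite_sdeg)
  show "DU_series t r \<in> sym_fun_XY"
    by (auto simp: sym_fun_XY_def DU_series_def map_key_map_sum U_seq_map_key D_seq_map_key)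
  have deg: "sdeg s = sdeg t + m * int (mdeg \<alpha>)" if "ip (U_seq \<alpha> (v t)) (v s) \<noteq> 0" for s \<alpha>
    using ip_nonzero_imp_sdeg[OF U_seq_graded[OF basis_homogeneous] that] .
  then show "s \<in> {s. sdeg s = sdeg t + m * int (mdeg (Poly_Mapping.map_key Inl \<mu>))}"
    if "mcoeff (in_X (skew_F a act v ip s t) * in_Y (skew_G a act v ip s r)) \<mu> \<noteq> 0" for s \<mu>
    using that by (simp add: mcoeff_in_X_times_in_Y skew_F_def skew_G_def)
  show "mcoeff (DU_series t r) \<mu> =
      (\<Sum>s | sdeg s = sdeg t + m * int (mdeg (Poly_Mapping.map_key Inl \<mu>)).
        mcoeff (in_X (skew_F a act v ip s t) * in_Y (skew_G a act v ip s r)) \<mu>)" for \<mu>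
    using functional_expansion[OF linear_comp_apply[OF linear_D_seq ip_linear_left[of "v r"]] finite_sdeg,
        of "U_seq (Poly_Mapping.map_key Inl \<mu>) (v t)"] deg
    by (simp add: DU_series_def mcoeff_in_X_times_in_Y skew_F_def skew_G_def)
qed

end

theorem theorem9:
  fixes scale :: "'k::field_char_0 \<Rightarrow> 'v::ab_group_add \<Rightarrow> 'v"
    and a :: "int \<Rightarrow> 'k"
    and v :: "'s \<Rightarrow> 'v"
  assumes a_nonzero: "\<And>k. k \<noteq> 0 \<Longrightarrow> a k \<noteq> 0"
    and a_even: "\<And>k. k \<noteq> 0 \<Longrightarrow> a k = a (- k)"
    and kappa: "power_sum_specialization a \<kappa>"
    and rep: "graded_heisenberg_rep scale a act v sdeg gr m ip"
  shows "\<exists>\<Omega>. has_formal_prod (\<lambda>(j, k). diag_series (\<lambda>n. \<kappa> (complete_sym n)) j k) \<Omega> \<and>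
           (\<forall>b. highest_weight_vector a act (v b) \<longrightarrow>
              has_completed_sum
                (\<lambda>s. in_X (skew_F a act v ip s b) * in_Y (skew_G a act v ip s b)) \<Omega>) \<and>
           (\<forall>r t. \<exists>R.
              has_completed_sum
                (\<lambda>s. in_X (skew_F a act v ip r s) * in_Y (skew_G a act v ip t s)) R \<and>
              has_completed_sum
                (\<lambda>s. in_X (skew_F a act v ip s t) * in_Y (skew_G a act v ip s r)) (\<Omega> * R))"
proof -
  interpret heisenberg_cauchy scale a act v sdeg gr m ip \<kappa>
    by (rule heisenberg_cauchy.intro[OF rep kappa])
  show ?thesis
  proof (rule exI[of _ "diag_prod hspec"], intro conjI allI impI)
    show "has_formal_prod (\<lambda>(j, k). diag_series hspec j k) (diag_prod hspec)"
      by (rule has_formal_prod_diag_prod) (rule kappa_complete_sym_0)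
    \<comment> \<open>The case \<open>t = r = b\<close> of the reordering, where the remaining
      factor is 1.\<close>
    show "has_completed_sum (\<lambda>s. in_X (skew_F a act v ip s b) * in_Y (skew_G a act v ip s b))
        (diag_prod hspec)" if "highest_weight_vector a act (v b)" for b
      using has_completed_sum_DU[of b b] by (simp add: DU_series_eq UD_series_highest_weight[OF that])
    \<comment> \<open>The witness \<open>R\<close> is \<open>UD_series t r\<close>.\<close>
    show "\<exists>R. has_completed_sum
          (\<lambda>s. in_X (skew_F a act v ip r s) * in_Y (skew_G a act v ip t s)) R \<and>
        has_completed_sum
          (\<lambda>s. in_X (skew_F a act v ip s t) * in_Y (skew_G a act v ip s r)) (diag_prod hspec * R)" for r t
      using has_completed_sum_UD[of r t] has_completed_sum_DU[of t r] by (auto simp: DU_series_eq)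
  qed
qed

end
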